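(* Let $k\ge 1$ be an integer. For all $x\in\mathbb C\setminus(-\infty,0]$, the function $\mathcal F_k$ satisfies $$\mathcal F_k(x)=\frac1x\sum_{j=1}^k\binom{k-1}{j-1}\log^{k-j}\!\Big(\frac1x\Big)\,\mathcal F_j\!\Big(\frac1x\Big)$$ and $$\mathcal F_k(x)-\mathcal F_k(x+1)-\frac1{x+1}\sum_{j=1}^k\binom{k-1}{j-1}\log^{k-j}\!\Big(\frac1{x+1}\Big)\,\mathcal F_j\!\Big(\frac{x}{x+1}\Big)=0.$$
   Context: Notation: $\log$ is the principal logarithm, $\log^a x=(\log x)^a$ (equal to $1$ when $a=0$), $\zeta$ is the Riemann zeta function, and $\gamma_m$ are the Stieltjes (generalized Euler) constants, $\zeta(s)=\frac1{s-1}+\sum_{m\ge 0}\frac{(-1)^m\gamma_m}{m!}(s-1)^m$. Generalized gamma function: for $k\ge 0$ and $x\in\mathbb C\setminus(-\infty,0]$, $$\Gamma_k(x)=\lim_{n\to\infty}\frac{\exp\!\big(\frac{\log^{k+1}n}{k+1}x\big)\prod_{j=1}^n\exp\!\big(\frac{\log^{k+1}j}{k+1}\big)}{\prod_{j=0}^n\exp\!\big(\frac{\log^{k+1}(j+x)}{k+1}\big)},\qquad \psi_k(x)=\frac{\Gamma_k'(x)}{\Gamma_k(x)}$$ (so $\psi_k(x)=\lim_{n\to\infty}\big(\frac{\log^{k+1}n}{k+1}-\sum_{j=0}^n\frac{\log^k(j+x)}{j+x}\big)$). For $k\ge 1$ and $x\in\mathbb C\setminus(-\infty,0]$, $$\mathfrak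 F_k^0(x)=\sum_{n=1}^\infty\left[\psi_{k-1}(nx)+\frac{\log^{k-1}(nx)}{2nx}-\frac{\log^k(nx)}{k}\right],$$ $$\mathcal F_k(x)=(-1)^{k-1}\mathfrak F_k^0(x)-\sum_{l=0}^k\frac{(-1)^l}{k}\binom kl\log^l(x)\,\zeta^{(k-l)}(0)-\frac12(-1)^{k-1}\gamma_{k-1}.$$ *)

theory Defs
  imports "HOL-Complex_Analysis.Complex_Analysis"
begin

text \<open>
  The unique analytic continuation of the Dirichlet series to the complex plane without 1.
  The value at the pole is immaterial; it is fixed to 0 only so that the description is unique.
\<close>

definition riemann_zeta :: "complex \<Rightarrow> complex" where
  "riemann_zeta = (THE f. f holomorphic_on (-{1}) \<and>
     (\<forall>s. Re s > 1 \<longrightarrow> (\<lambda>n. of_nat (Suc n) powr (-s)) sums f s) \<and> f 1 = 0)"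

text \<open>
  The coefficients of the Laurent expansion of zeta at 1. The regular part is entire, so the
  expansion is valid at every point other than 1.
\<close>

definition stieltjes_gamma :: "nat \<Rightarrow> complex" where
  "stieltjes_gamma = (THE g. \<forall>s. s \<noteq> 1 \<longrightarrow>
     (\<lambda>m. (-1) ^ m * g m / fact m * (s - 1) ^ m) sums (riemann_zeta s - 1 / (s - 1)))"

text \<open>
  In the following, only arguments off the closed negative real axis are meaningful. On complex
  arguments \<open>ln\<close> is the principal branch; the term \<open>n = 0\<close>, where \<open>ln 0 = 0\<close>, does not affect
  the limit.
\<close>

definition gen_Gamma :: "nat \<Rightarrow> complex \<Rightarrow> complex" where
  "gen_Gamma k x = lim (\<lambda>n::nat.
     exp (ln (of_nat n) ^ (k + 1) / of_nat (k + 1) * x) *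
     (\<Prod>j=1..n. exp (ln (of_nat j) ^ (k + 1) / of_nat (k + 1))) /
     (\<Prod>j=0..n. exp (ln (of_nat j + x) ^ (k + 1) / of_nat (k + 1))))"

definition gen_psi :: "nat \<Rightarrow> complex \<Rightarrow> complex" where
  "gen_psi k x = deriv (gen_Gamma k) x / gen_Gamma k x"

definition frakF0 :: "nat \<Rightarrow> complex \<Rightarrow> complex" where
  "frakF0 k x = (\<Sum>m. let n = of_nat (Suc m) in
     gen_psi (k - 1) (n * x) + ln (n * x) ^ (k - 1) / (2 * n * x) - ln (n * x) ^ k / of_nat k)"

definition calF :: "nat \<Rightarrow> complex \<Rightarrow> complex" where
  "calF k x = (-1) ^ (k - 1) * frakF0 k x
     - (\<Sum>l=0..k. (-1) ^ l / of_nat k * of_nat (k choose l) * ln x ^ l *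
          (deriv ^^ (k - l)) riemann_zeta 0)
     - 1 / 2 * (-1) ^ (k - 1) * stieltjes_gamma (k - 1)"

end

(*
  Let E(s, x) be the sum of (m x + n)^(-s) over the lattice points m, n >= 0 other than the origin,
  the boundary rays m = 0 and n = 0 having weight 1/2. For Re s > 2, interchanging m and n gives
  E(s, x) = x^(-s) E(s, 1/x), and splitting the cone along its diagonal gives
  E(s, x) = E(s, x + 1) + (x + 1)^(-s) E(s, x/(x + 1)).
  Comparing the sum over n with the integral by the trapezoid rule yields
    E(s, x) = G(s, x) + x^(1-s) zeta(s - 1)/(s - 1) + zeta(s)/2,
  where G is a double sum of trapezoid errors that is holomorphic for Re s > 0. The poles of the last
  two terms at s = 1 cancel, and the (k-1)st derivative of E at s = 1 is -F_k(x). Both claims are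
  therefore the Leibniz rule for the (k-1)st derivatives at s = 1 of the two identities for E.
*)

theory Submission
  imports Defs
begin

text \<open>The identities for E come from absolutely convergent sums and need Re s > 2, while the
  claims concern s = 1; between the two lies the pole of zeta(s - 1) at s = 2. With u = s - 1, both
  sides are compared on the disc of radius 3/2 about u = 1 with its centre removed. This set is
  connected, contains u = 0, meets Re u > 1 and stays in Re u > -1/2. The trapezoid rule is chosen
  for its accuracy: a sum over a planar lattice needs decay faster than |z|^(-2). The error of the
  trapezoid rule is of order |z|^(-3 - Re u); a one-sided Riemann sum would leave |z|^(-2 - Re u),
  which is not absolutely summable at u = 0. The half weights also produce the terms
  log^(k-1)(nx)/(2nx) of the definition. All powers are principal. They multiply as needed because
  every lattice point lies in the sector spanned by 1 and x, whose opening is less than pi. Zeta and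
  the Stieltjes constants are definite descriptions, so a continuation and a Laurent expansion must
  be constructed before their values can be used.\<close>

section \<open>Termwise differentiation of series of holomorphic functions\<close>

lemma higher_deriv_partial_sum:
  fixes f :: "nat \<Rightarrow> complex \<Rightarrow> complex"
  assumes "open S" "\<And>n. f n holomorphic_on S" "s \<in> S"
  shows "(deriv ^^ p) (\<lambda>s. \<Sum>n<N. f n s) s = (\<Sum>n<N. (deriv ^^ p) (f n) s)"
proof (induction N)
  case (Suc N)
  have "(deriv ^^ p) (\<lambda>s. (\<Sum>n<N. f n s) + f N s) s
      = (deriv ^^ p) (\<lambda>s. \<Sum>n<N. f n s) s + (deriv ^^ p) (f N) s"
    by (rule higher_deriv_add[of _ S]) (use assms in \<open>auto intro!: holomorphic_intros\<close>)
  then show ?case using Suc by simp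
qed simp

text \<open>Uniform convergence of holomorphic functions on an open set carries over to all
  derivatives at its points, so a majorant for \<open>f n\<close> alone suffices and no derivative
  has to be estimated.\<close>

lemma
  fixes f :: "nat \<Rightarrow> complex \<Rightarrow> complex"
  assumes S: "open S" and hol: "\<And>n. f n holomorphic_on S"
    and le: "\<And>n s. s \<in> S \<Longrightarrow> norm (f n s) \<le> M n" and M: "summable M"
  shows holomorphic_on_suminf: "(\<lambda>s. \<Sum>n. f n s) holomorphic_on S"
    and higher_deriv_sums:
      "s \<in> S \<Longrightarrow> (\<lambda>n. (deriv ^^ p) (f n) s) sums (deriv ^^ p) (\<lambda>s. \<Sum>n. f n s) s"
proof -
  have ul: "uniform_limit S (\<lambda>N s. \<Sum>n<N. f n s) (\<lambda>s. \<Sum>n. f n s) sequentially"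
    by (rule Weierstrass_m_test[OF le M])
  show "(\<lambda>s. \<Sum>n. f n s) holomorphic_on S"
  proof (rule holomorphic_uniform_sequence[OF S, of "\<lambda>N s. \<Sum>n<N. f n s"])
    show "(\<lambda>s. \<Sum>n<N. f n s) holomorphic_on S" for N
      using hol by (auto intro!: holomorphic_intros)
    show "\<exists>d>0. cball x d \<subseteq> S \<and>
        uniform_limit (cball x d) (\<lambda>N s. \<Sum>n<N. f n s) (\<lambda>s. \<Sum>n. f n s) sequentially" if "x \<in> S" for x
      using S that uniform_limit_on_subset[OF ul] unfolding open_contains_cball by meson
  qed
  show "(\<lambda>n. (deriv ^^ p) (f n) s) sums (deriv ^^ p) (\<lambda>s. \<Sum>n. f n s) s" if s: "s \<in> S"
  proof -
    have "(\<lambda>N. (deriv ^^ p) (\<lambda>s. \<Sum>n<N. f n s) s) \<longlonglongrightarrow> (deriv ^^ p) (\<lambda>s. \<Sum>n. f n s) s"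
      by (rule higher_deriv_complex_uniform_limit[OF ul _ _ S s])
         (use hol in \<open>auto intro!: always_eventually holomorphic_intros\<close>)
    then show ?thesis
      unfolding sums_def using higher_deriv_partial_sum[OF S hol s] by simp
  qed
qed

subsection \<open>Analytic continuation of the zeta function\<close>

text \<open>The Taylor remainder of order \<open>J\<close> of z powr (1 - s), expanded at n + 1 and
  evaluated one step further. Each additional order improves its decay in n by one power.\<close>

definition powr_remainder :: "nat \<Rightarrow> nat \<Rightarrow> complex \<Rightarrow> complex" where
  "powr_remainder J n s = of_nat (Suc (Suc n)) powr (1 - s) -
     (\<Sum>j\<le>J. ((1 - s) gchoose j) * of_nat (Suc n) powr (1 - s - of_nat j))"

text \<open>Taylor's theorem with the derivative of order J + 1. The hypothesis makes the modulus of
  that derivative nonincreasing along the segment, so its value at the left end bounds it.\<close>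

lemma norm_powr_remainder_le:
  assumes "Re s + real J \<ge> 0"
  shows "norm (powr_remainder J n s) \<le>
    norm (\<Prod>l<Suc J. 1 - s - of_nat l) * real (Suc n) powr (- Re s - real J)"
proof -
  define N where "N = real (Suc n)"
  have N: "N > 0" by (simp add: N_def)
  \<comment> \<open>The derivative of order i of z powr (1 - s).\<close>
  define f where "f = (\<lambda>i z. (\<Prod>l<i. 1 - s - of_nat l) * z powr (1 - s - of_nat i) :: complex)"
  define T where "T = closed_segment (of_real N) (of_real (N + 1) :: complex)"
  have T: "\<exists>t. z = of_real t \<and> N \<le> t" if "z \<in> T" for z
    using that unfolding T_def closed_segment_of_real by (auto simp: closed_segment_eq_real_ivl)
  have "norm (f 0 (of_real (N + 1)) - (\<Sum>i\<le>J. f i (of_real N) * (of_real (N + 1) - of_real N) ^ i / fact i))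
    \<le> norm (\<Prod>l<Suc J. 1 - s - of_nat l) * N powr (- Re s - real J)
       * norm (of_real (N + 1) - of_real N :: complex) ^ Suc J / fact J"
  proof (rule complex_Taylor)
    show "convex T" by (simp add: T_def)
    fix i z assume z: "z \<in> T"
    then obtain t where t: "z = of_real t" "N \<le> t" using T by blast
    have nz: "z \<notin> \<real>\<^sub>\<le>\<^sub>0" using t N by (auto simp: complex_nonpos_Reals_iff)
    show "(f i has_field_derivative f (Suc i) z) (at z within T)"
    proof -
      have "(f i has_field_derivative (\<Prod>l<i. 1 - s - of_nat l) *
          ((1 - s - of_nat i) * z powr (1 - s - of_nat i - 1))) (at z)"
        unfolding f_def by (intro DERIV_cmult has_field_derivative_powr nz)
      also have "(\<Prod>l<i. 1 - s - of_nat l) * ((1 - s - of_nat i) * z powr (1 - s - of_nat i - 1))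
          = f (Suc i) z"
        by (simp add: f_def algebra_simps)
      finally show ?thesis by (rule has_field_derivative_at_within)
    qed
    have "norm (z powr (1 - s - of_nat (Suc J))) = t powr (- Re s - real J)"
      using t N by (subst norm_powr_real_powr) auto
    also have "\<dots> \<le> N powr (- Re s - real J)"
      using t N assms by (intro powr_mono2') auto
    finally show "norm (f (Suc J) z) \<le> norm (\<Prod>l<Suc J. 1 - s - of_nat l) * N powr (- Re s - real J)"
      unfolding f_def norm_mult by (intro mult_left_mono) auto
  qed (auto simp: T_def)
  also have "f 0 (of_real (N + 1)) - (\<Sum>i\<le>J. f i (of_real N) * (of_real (N + 1) - of_real N) ^ i / fact i)
      = powr_remainder J n s"
    unfolding powr_remainder_def f_def N_def
    by (simp add: gbinomial_prod_rev atLeast0LessThan add_ac)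
  also have "norm (\<Prod>l<Suc J. 1 - s - of_nat l) * N powr (- Re s - real J)
       * norm (of_real (N + 1) - of_real N :: complex) ^ Suc J / fact J
     \<le> norm (\<Prod>l<Suc J. 1 - s - of_nat l) * N powr (- Re s - real J) * 1 / 1"
    by (intro frac_le mult_mono) (auto simp: fact_ge_1)
  finally show ?thesis by (simp add: N_def)
qed

lemma summable_Suc_powr: "p > 1 \<Longrightarrow> summable (\<lambda>n. real (Suc n) powr (- p))"
  using summable_real_powr_iff[of "- p"] by (subst summable_Suc_iff) auto

lemma holomorphic_suminf_powr_remainder:
  "(\<lambda>s. \<Sum>n. powr_remainder J n s) holomorphic_on {s. Re s > 1 - real J}"
proof -
  have *: "\<exists>d>0. (\<lambda>s. \<Sum>n. powr_remainder J n s) holomorphic_on ball s0 d" if s0: "Re s0 > 1 - real J" for s0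
  proof -
    \<comment> \<open>Half the distance of s0 from the line Re s = 1 - J, so that Re s + J > 1 + d
      on the whole ball and one convergent majorant serves there.\<close>
    define d where "d = (Re s0 + J - 1) / 2"
    have d: "d > 0" using s0 by (simp add: d_def)
    define C where "C = (\<Prod>l<Suc J. 1 + norm s0 + d + real l)"
    have le: "norm (powr_remainder J n s) \<le> C * real (Suc n) powr (- (1 + d))"
      if s: "s \<in> ball s0 d" for n s
    proof -
      have "\<bar>Re s - Re s0\<bar> < d"
        using s abs_Re_le_cmod[of "s - s0"] by (auto simp: dist_norm norm_minus_commute)
      moreover have "Re s0 + J = 1 + 2 * d" by (simp add: d_def field_simps)
      ultimately have Re: "Re s + J \<ge> 1 + d" by linarith
      have "norm s \<le> norm s0 + d"
        using s norm_triangle_ineq2[of s s0] by (auto simp: dist_norm norm_minus_commute)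
      then have nl: "norm (1 - s - of_nat l) \<le> 1 + norm s0 + d + real l" for l
        using norm_triangle_ineq4[of "1 - s" "of_nat l"] norm_triangle_ineq4[of 1 s] by simp
      have "norm (powr_remainder J n s) \<le>
          norm (\<Prod>l<Suc J. 1 - s - of_nat l) * real (Suc n) powr (- Re s - real J)"
        by (rule norm_powr_remainder_le) (use Re d in linarith)
      also have "\<dots> \<le> C * real (Suc n) powr (- (1 + d))"
        unfolding C_def prod_norm[symmetric]
        by (intro mult_mono powr_mono prod_mono prod_nonneg conjI nl norm_ge_zero) (use Re d in auto)
      finally show ?thesis .
    qed
    have sm: "summable (\<lambda>n. C * real (Suc n) powr (- (1 + d)))"
      by (intro summable_mult summable_Suc_powr) (use d in auto)
    have hol: "powr_remainder J n holomorphic_on ball s0 d" for n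
      unfolding powr_remainder_def [abs_def] gbinomial_prod_rev
      by (auto intro!: holomorphic_intros)
    from d holomorphic_on_suminf[OF open_ball hol le sm] show ?thesis by blast
  qed
  show "(\<lambda>s. \<Sum>n. powr_remainder J n s) holomorphic_on {s. Re s > 1 - real J}"
  proof (rule holomorphic_onI)
    fix s0 assume "s0 \<in> {s. Re s > 1 - real J}"
    then have "Re s0 > 1 - real J" by simp
    from *[OF this] obtain d where
      "d > 0" "(\<lambda>s. \<Sum>n. powr_remainder J n s) holomorphic_on ball s0 d"
      by (elim exE conjE)
    then show "(\<lambda>s. \<Sum>n. powr_remainder J n s) field_differentiable at s0 within {s. Re s > 1 - real J}"
      by (auto intro: field_differentiable_at_within[OF holomorphic_on_imp_differentiable_at])
  qed
qed

definition dirichlet_zeta :: "complex \<Rightarrow> complex" where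
  "dirichlet_zeta s = (\<Sum>n. of_nat (Suc n) powr (- s))"

lemma norm_Suc_powr: "norm (of_nat (Suc n) powr (- s) :: complex) = real (Suc n) powr (- Re s)"
  by (subst norm_powr_real_powr) auto

lemma dirichlet_zeta_sums:
  assumes "Re s > 1"
  shows "(\<lambda>n. of_nat (Suc n) powr (- s)) sums dirichlet_zeta s"
  unfolding dirichlet_zeta_def
proof (rule summable_sums, rule summable_norm_cancel)
  show "summable (\<lambda>n. norm (of_nat (Suc n) powr (- s) :: complex))"
    unfolding norm_Suc_powr using summable_Suc_powr[OF assms] .
qed

text \<open>
  Summing the binomial expansion of (n + 1) powr (1 - s) - n powr (1 - s) over n telescopes. Each
  term of the resulting recurrence contains zeta (s + i) multiplied by s + i - 1, so that no poles arise.
\<close>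

lemma dirichlet_zeta_recurrence:
  assumes s: "Re s > 1"
  shows "(s - 1) * dirichlet_zeta s = 1 + (\<Sum>n. powr_remainder (Suc I) n s) -
    (\<Sum>i=1..I. ((1 - s) gchoose i) / of_nat (Suc i) * ((s + of_nat i - 1) * dirichlet_zeta (s + of_nat i)))"
proof -
  define D where "D = (\<lambda>i. ((1 - s) gchoose i) / of_nat (Suc i) * ((s + of_nat i - 1) * dirichlet_zeta (s + of_nat i)))"
  \<comment> \<open>The next binomial coefficient brings in the factor 1 - s - i, which is minus the
    factor s + i - 1 that removes the pole of zeta(s + i).\<close>
  have g: "((1 - s) gchoose Suc i) * dirichlet_zeta (s + of_nat i) = - D i" for i
  proof -
    have "((1 - s) gchoose Suc i) = ((1 - s) gchoose i) * (1 - s - of_nat i) / of_nat (Suc i)"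
      by (simp add: gbinomial_prod_rev field_simps del: of_nat_Suc)
    moreover have "X = g * c / m \<Longrightarrow> X * z = - (g / m * (- c * z))" for X g c m z :: complex
      by simp
    ultimately have "((1 - s) gchoose Suc i) * dirichlet_zeta (s + of_nat i) =
        - (((1 - s) gchoose i) / of_nat (Suc i) * (- (1 - s - of_nat i) * dirichlet_zeta (s + of_nat i)))"
      by blast
    then show ?thesis by (simp add: D_def add_diff_eq diff_diff_eq2 add.commute)
  qed
  have ten: "(\<lambda>n. of_nat (Suc n) powr (1 - s)) \<longlonglongrightarrow> (0 :: complex)"
    using tendsto_neg_powr_complex_of_nat[of Suc sequentially "1 - s"] s filterlim_Suc
    by (simp del: of_nat_Suc)
  have 1: "(\<lambda>n. of_nat (Suc (Suc n)) powr (1 - s) - of_nat (Suc n) powr (1 - s)) sums (0 - of_nat (Suc 0) powr (1 - s))"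
    by (rule telescope_sums[OF ten])
  have 2: "(\<lambda>n. \<Sum>i\<le>I. ((1 - s) gchoose Suc i) * of_nat (Suc n) powr (- (s + of_nat i)))
       sums (\<Sum>i\<le>I. ((1 - s) gchoose Suc i) * dirichlet_zeta (s + of_nat i))"
    by (intro sums_sum sums_mult dirichlet_zeta_sums) (use s in auto)
  have "(\<lambda>n. powr_remainder (Suc I) n s) sums
     ((0 - of_nat (Suc 0) powr (1 - s)) - (\<Sum>i\<le>I. ((1 - s) gchoose Suc i) * dirichlet_zeta (s + of_nat i)))"
    using sums_diff[OF 1 2]
    by (simp add: powr_remainder_def sum.atMost_Suc_shift algebra_simps del: of_nat_Suc sum.atMost_Suc)
       (simp add: algebra_simps)
  then have "(\<Sum>n. powr_remainder (Suc I) n s) = - 1 + (\<Sum>i\<le>I. D i)"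
    by (simp add: sums_iff g sum_negf del: sum.atMost_Suc)
  \<comment> \<open>\<open>D 0\<close> is (s - 1) zeta(s), the quantity for which the relation is
    solved.\<close>
  moreover have "(\<Sum>i\<le>I. D i) = D 0 + (\<Sum>i=1..I. D i)"
    by (simp add: atMost_atLeast0 sum.atLeast_Suc_atMost)
  ultimately show ?thesis by (simp add: D_def)
qed

text \<open>\<open>F\<close> stands for a continuation of (s - 1) zeta(s), a function without
  pole.\<close>

definition zeta_recurrence :: "(complex \<Rightarrow> complex) \<Rightarrow> nat \<Rightarrow> complex \<Rightarrow> complex" where
  "zeta_recurrence F I s = 1 + (\<Sum>n. powr_remainder (Suc I) n s) -
    (\<Sum>i=1..I. ((1 - s) gchoose i) / of_nat (Suc i) * F (s + of_nat i))"

lemma holomorphic_zeta_recurrence: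
  assumes "I = 0 \<or> F holomorphic_on {s. Re s > 1 - real I}"
  shows "zeta_recurrence F I holomorphic_on {s. Re s > - real I}"
proof -
  have "(\<lambda>s. F (s + of_nat i)) holomorphic_on {s. Re s > - real I}" if "i \<in> {1..I}" for i
  proof -
    have "(F \<circ> (\<lambda>s. s + of_nat i)) holomorphic_on {s. Re s > - real I}"
      by (rule holomorphic_on_compose_gen[of _ _ _ "{s. Re s > 1 - real I}"])
         (use assms that in \<open>auto intro!: holomorphic_intros\<close>)
    then show ?thesis by (simp add: o_def)
  qed
  moreover have "(\<lambda>s. \<Sum>n. powr_remainder (Suc I) n s) holomorphic_on {s. Re s > - real I}"
    using holomorphic_suminf_powr_remainder[of "Suc I"] by simp
  ultimately show ?thesis
    unfolding zeta_recurrence_def [abs_def] gbinomial_prod_rev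
    by (auto intro!: holomorphic_intros simp del: of_nat_Suc)
qed

lemma zeta_recurrence_eq:
  assumes "Re s > 1" and "\<And>i. i \<in> {1..I} \<Longrightarrow> F (s + of_nat i) = (s + of_nat i - 1) * dirichlet_zeta (s + of_nat i)"
  shows "zeta_recurrence F I s = (s - 1) * dirichlet_zeta s"
  unfolding zeta_recurrence_def dirichlet_zeta_recurrence[OF assms(1), of I]
  using assms(2) by simp

text \<open>The recurrence expresses the value at s through values at s + 1, s + 2, ..., so each use
  of it widens the half-plane by one. For \<open>I = 0\<close> the sum is empty and any
  \<open>F\<close>, here 0, starts the induction.\<close>

lemma zeta_half_plane_extension:
  "\<exists>F. F holomorphic_on {s. Re s > - real I} \<and> (\<forall>s. Re s > 1 \<longrightarrow> F s = (s - 1) * dirichlet_zeta s)"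
proof (induction I)
  case 0
  then show ?case
    using holomorphic_zeta_recurrence[of 0 "\<lambda>_. 0"] zeta_recurrence_eq[of _ 0 "\<lambda>_. 0"] by force
next
  case (Suc I)
  then obtain F where F: "F holomorphic_on {s. Re s > - real I}"
    "\<And>s. Re s > 1 \<Longrightarrow> F s = (s - 1) * dirichlet_zeta s" by blast
  have "zeta_recurrence F (Suc I) holomorphic_on {s. Re s > - real (Suc I)}"
    by (rule holomorphic_zeta_recurrence) (use F in simp)
  moreover have "zeta_recurrence F (Suc I) s = (s - 1) * dirichlet_zeta s" if "Re s > 1" for s
    by (rule zeta_recurrence_eq[OF that]) (use F(2) that in simp)
  ultimately show ?case by blast
qed

lemma half_plane_identity:
  assumes "f holomorphic_on {s. Re s > a}" "g holomorphic_on {s. Re s > a}" "a \<le> b"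
    "\<And>s. Re s > b \<Longrightarrow> f s = g s" "Re s > a"
  shows "f s = g s"
proof (rule analytic_continuation_open[of "{s. Re s > b}" "{s. Re s > a}" f g])
  show "open {s. Re s > b}" "open {s. Re s > a}" by (simp_all add: open_halfspace_Re_gt)
  show "connected {s. Re s > a}" by (rule convex_connected[OF convex_halfspace_Re_gt])
  show "{s. Re s > b} \<noteq> {}"
    by (auto intro!: exI[of _ "of_real (b + 1)"])
qed (use assms in auto)

lemma zeta_entire_extension:
  obtains F where "F holomorphic_on UNIV" "\<And>s. Re s > 1 \<Longrightarrow> F s = (s - 1) * dirichlet_zeta s"
proof -
  obtain G where G: "\<And>I. G I holomorphic_on {s. Re s > - real I}"
    "\<And>I s. Re s > 1 \<Longrightarrow> G I s = (s - 1) * dirichlet_zeta s"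
    using zeta_half_plane_extension by metis
  \<comment> \<open>The index exceeds |s|, so s lies in the half-plane belonging to it. As the
    continuations agree on common half-planes, \<open>F\<close> coincides with the single function
    \<open>G n\<close> on the disc of radius n.\<close>
  define F where "F s = G (nat \<lceil>norm s\<rceil> + 1) s" for s
  have mono: "G I s = G J s" if "I \<le> J" "Re s > - real I" for I J s
  proof (rule half_plane_identity[of "G I" "- real I" "G J" 1])
    show "G J holomorphic_on {s. - real I < Re s}"
      by (rule holomorphic_on_subset[OF G(1)[of J]]) (use that in auto)
  qed (use G that in auto)
  have F_eq: "F s = G n s" if "norm s < real n" for s n
  proof -
    define m where "m = nat \<lceil>norm s\<rceil> + 1"
    have "norm s < real m" unfolding m_def by linarith
    then have "Re s > - real m" "Re s > - real n"
      using that abs_Re_le_cmod[of s] by linarith+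
    then show ?thesis
      using mono[of m n s] mono[of n m s] nle_le[of m n] unfolding F_def m_def by metis
  qed
  have "F holomorphic_on UNIV"
  proof (rule holomorphic_onI)
    fix s0 :: complex
    define n where "n = nat \<lceil>norm s0\<rceil> + 1"
    have n: "norm s0 < real n" unfolding n_def by linarith
    have "Re s > - real n" if "norm s < real n" for s :: complex
      using that abs_Re_le_cmod[of s] by linarith
    then have "G n holomorphic_on ball 0 (real n)"
      by (intro holomorphic_on_subset[OF G(1)[of n]]) auto
    also have "?this \<longleftrightarrow> F holomorphic_on ball 0 (real n)"
      by (intro holomorphic_cong) (use F_eq in auto)
    finally show "F field_differentiable at s0 within UNIV"
      using holomorphic_on_imp_differentiable_at[of F "ball 0 (real n)" s0] n by simp
  qed
  moreover have "F s = (s - 1) * dirichlet_zeta s" if "Re s > 1" for s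
    unfolding F_def using G(2) that by blast
  ultimately show ?thesis using that by blast
qed

text \<open>The definite description is resolved: (s - 1) zeta(s) divided by s - 1 satisfies it, and
  the identity theorem on the connected punctured plane, together with the prescribed value at 1,
  gives uniqueness.\<close>

lemma
  shows holomorphic_riemann_zeta: "riemann_zeta holomorphic_on -{1}"
    and riemann_zeta_eq_dirichlet: "Re s > 1 \<Longrightarrow> riemann_zeta s = dirichlet_zeta s"
proof -
  obtain F where F: "F holomorphic_on UNIV" "\<And>s. Re s > 1 \<Longrightarrow> F s = (s - 1) * dirichlet_zeta s"
    using zeta_entire_extension by blast
  define P where "P f \<longleftrightarrow> f holomorphic_on (-{1}) \<and>
     (\<forall>s. Re s > 1 \<longrightarrow> (\<lambda>n. of_nat (Suc n) powr (-s)) sums f s) \<and> f 1 = 0" for f :: "complex \<Rightarrow> complex"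
  have ex: "P (\<lambda>s. if s = 1 then 0 else F s / (s - 1))"
  proof -
    have "(\<lambda>s. F s / (s - 1)) holomorphic_on -{1}"
      using holomorphic_on_subset[OF F(1)] by (auto intro!: holomorphic_intros)
    also have "?this \<longleftrightarrow> (\<lambda>s. if s = 1 then 0 else F s / (s - 1)) holomorphic_on -{1}"
      by (intro holomorphic_cong) auto
    finally show ?thesis
      unfolding P_def using F(2) dirichlet_zeta_sums by (auto simp del: of_nat_Suc)
  qed
  have uniq: "f = g" if f: "P f" and g: "P g" for f g
  proof
    fix s
    have "f s = g s" if "s \<noteq> 1"
    proof (rule analytic_continuation_open[of "{s. Re s > 1}" "-{1}" f g])
      show "{s. Re s > 1} \<noteq> {}" by (auto intro!: exI[of _ 2])
      show "connected (- {1::complex})"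
        by (rule connected_punctured_universe) simp
      show "f z = g z" if "z \<in> {s. Re s > 1}" for z
        using f g that sums_unique2[of "\<lambda>n. of_nat (Suc n) powr (-z)"] unfolding P_def by blast
    qed (use f g that in \<open>auto simp: P_def open_halfspace_Re_gt\<close>)
    then show "f s = g s" using f g by (cases "s = 1") (auto simp: P_def)
  qed
  have "P riemann_zeta"
    unfolding riemann_zeta_def P_def[symmetric] by (rule theI[where P = P, OF ex uniq[OF _ ex]])
  then show "riemann_zeta holomorphic_on -{1}"
    "Re s > 1 \<Longrightarrow> riemann_zeta s = dirichlet_zeta s"
    using sums_unique2[OF _ dirichlet_zeta_sums] unfolding P_def by auto
qed

text \<open>The two values come from the recurrence: z powr (1 - s) is constant in z for s = 1 and
  linear for s = 0, so all Taylor remainders vanish there. \<open>F 1\<close> is the residue of zeta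
  at 1, and \<open>F 0\<close> gives zeta(0) = -1/2.\<close>

lemma zeta_entire:
  obtains F where "F holomorphic_on UNIV" "\<And>s. s \<noteq> 1 \<Longrightarrow> F s = (s - 1) * riemann_zeta s"
    "F 1 = 1" "F 0 = 1 / 2"
proof -
  obtain F where F: "F holomorphic_on UNIV" "\<And>s. Re s > 1 \<Longrightarrow> F s = (s - 1) * dirichlet_zeta s"
    using zeta_entire_extension by blast
  have rec: "F s = zeta_recurrence F I s" if "Re s > - real I" for s I
  proof (rule half_plane_identity[of F "- real I" "zeta_recurrence F I" 1])
    show "zeta_recurrence F I holomorphic_on {s. - real I < Re s}"
      by (rule holomorphic_zeta_recurrence) (use holomorphic_on_subset[OF F(1)] in auto)
    show "F s = zeta_recurrence F I s" if "Re s > 1" for s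
      using that F(2) by (subst zeta_recurrence_eq) auto
  qed (use that holomorphic_on_subset[OF F(1)] in auto)
  have "powr_remainder (Suc 0) n 1 = 0" for n
    by (simp add: powr_remainder_def gbinomial_prod_rev del: of_nat_Suc)
  then have F1: "F 1 = 1"
    by (subst rec[of 0]) (simp_all add: zeta_recurrence_def)
  have "powr_remainder (Suc 1) n 0 = 0" for n
    using of_nat_neq_0[of n, where 'a = complex]
    by (simp add: powr_remainder_def gbinomial_prod_rev numeral_2_eq_2)
  then have F0: "F 0 = 1 / 2"
    using F1 by (subst rec[of 1]) (simp_all add: zeta_recurrence_def gbinomial_prod_rev)
  have "F s = (s - 1) * riemann_zeta s" if "s \<noteq> 1" for s
  proof (rule analytic_continuation_open[of "{s. Re s > 1}" "-{1}" F])
    show "{s. Re s > 1} \<noteq> {}" by (auto intro!: exI[of _ 2])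
    show "connected (- {1::complex})"
      by (rule connected_punctured_universe) simp
    show "F z = (z - 1) * riemann_zeta z" if "z \<in> {s. Re s > 1}" for z
      using that F(2) riemann_zeta_eq_dirichlet by simp
  qed (use that holomorphic_on_subset[OF F(1)] holomorphic_riemann_zeta
       in \<open>auto simp: open_halfspace_Re_gt intro!: holomorphic_intros\<close>)
  then show ?thesis using F(1) F1 F0 that by blast
qed

lemma riemann_zeta_0: "riemann_zeta 0 = - 1 / 2"
  by (rule zeta_entire) (metis (no_types) diff_0 mult_minus1 minus_divide_left zero_neq_one minus_equation_iff)

section \<open>Stieltjes constants as derivatives of the regular part of zeta at 1\<close>

text \<open>The expansion is assumed away from 0 only. After multiplication by u it holds at 0 as
  well, and the factor \<open>fps_X\<close> cancels from the resulting identity of power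
  series.\<close>

lemma power_series_coefficients_unique:
  fixes a :: "nat \<Rightarrow> complex"
  assumes "H holomorphic_on UNIV" and "\<And>u. u \<noteq> 0 \<Longrightarrow> (\<lambda>m. a m * u ^ m) sums H u"
  shows "a m = (deriv ^^ m) H 0 / fact m"
proof -
  have "(\<lambda>u. u * H u) has_fps_expansion fps_X * Abs_fps a"
  proof (rule has_fps_expansionI, rule always_eventually, rule allI)
    fix u :: complex
    have "(\<lambda>m. u * (a m * u ^ m)) sums (u * H u)"
      using assms(2) by (cases "u = 0") (auto intro: sums_mult)
    then have "(\<lambda>m. fps_nth (fps_X * Abs_fps a) (Suc m) * u ^ Suc m) sums (u * H u)"
      by (simp add: mult_ac)
    then show "(\<lambda>m. fps_nth (fps_X * Abs_fps a) m * u ^ m) sums (u * H u)"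
      by (subst (asm) sums_Suc_iff) simp
  qed
  moreover have H: "H has_fps_expansion fps_expansion H 0"
    using assms(1) by blast
  then have "(\<lambda>u. u * H u) has_fps_expansion fps_X * fps_expansion H 0"
    by (intro fps_expansion_intros)
  ultimately have "fps_X * Abs_fps a = fps_X * fps_expansion H 0"
    by (rule fps_expansion_unique_complex)
  then have "Abs_fps a = fps_expansion H 0" by simp
  then have "a m = fps_nth (fps_expansion H 0) m" by (metis fps_nth_Abs_fps)
  then show ?thesis by (simp add: fps_expansion_def)
qed

lemma zeta_laurent:
  obtains H where "H holomorphic_on UNIV" "\<And>u. u \<noteq> 0 \<Longrightarrow> riemann_zeta (1 + u) = 1 / u + H u"
    "\<And>m. (deriv ^^ m) H 0 = (- 1) ^ m * stieltjes_gamma m"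
proof -
  obtain F where F: "F holomorphic_on UNIV" "\<And>s. s \<noteq> 1 \<Longrightarrow> F s = (s - 1) * riemann_zeta s" "F 1 = 1"
    using zeta_entire by blast
  have hol: "(\<lambda>u. F (1 + u)) holomorphic_on UNIV"
    using holomorphic_on_compose_gen[of "\<lambda>u. 1 + u" UNIV F UNIV] F(1)
    by (simp add: o_def holomorphic_on_add)
  \<comment> \<open>As \<open>F 1\<close> is 1, this is zeta(1 + u) - 1/u with its removable
    singularity filled; the residue is written in the form that \<open>pole_theorem_open\<close>
    expects.\<close>
  define H where "H u = (if u = 0 then deriv (\<lambda>u. F (1 + u)) 0 else riemann_zeta (1 + u) - F (1 + 0) / (u - 0))" for u
  have holH: "H holomorphic_on UNIV"
    unfolding H_def by (rule pole_theorem_open[OF hol]) (use F(2) in auto)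
  have H: "riemann_zeta (1 + u) = 1 / u + H u" if "u \<noteq> 0" for u
    using that F(3) by (simp add: H_def)
  define P where "P g \<longleftrightarrow> (\<forall>s. s \<noteq> 1 \<longrightarrow>
     (\<lambda>m. (-1) ^ m * g m / fact m * (s - 1) ^ m) sums (riemann_zeta s - 1 / (s - 1)))" for g :: "nat \<Rightarrow> complex"
  \<comment> \<open>An equivalence with an explicit equation settles existence and uniqueness for
    the definite description at once.\<close>
  have P: "P g \<longleftrightarrow> g = (\<lambda>m. (- 1) ^ m * (deriv ^^ m) H 0)" for g
  proof
    assume "P g"
    then have "(\<lambda>m. ((-1) ^ m * g m / fact m) * u ^ m) sums H u" if "u \<noteq> 0" for u
      using that H[OF that] unfolding P_def by (auto dest: spec[of _ "1 + u"])
    then have eq: "(-1) ^ m * g m / fact m = (deriv ^^ m) H 0 / fact m" for m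
      using power_series_coefficients_unique[OF holH, of "\<lambda>m. (-1) ^ m * g m / fact m"] by blast
    show "g = (\<lambda>m. (- 1) ^ m * (deriv ^^ m) H 0)"
    proof
      fix m
      have "g m = (- 1) ^ m * ((- 1) ^ m * g m)"
        by (simp add: mult.assoc[symmetric] flip: power_mult_distrib)
      also have "(- 1) ^ m * g m = (deriv ^^ m) H 0"
        using eq[of m] by simp
      finally show "g m = (- 1) ^ m * (deriv ^^ m) H 0" .
    qed
  next
    assume g: "g = (\<lambda>m. (- 1) ^ m * (deriv ^^ m) H 0)"
    show "P g" unfolding P_def
    proof (intro allI impI)
      fix s :: complex assume "s \<noteq> 1"
      then have "H (s - 1) = riemann_zeta s - 1 / (s - 1)" using H[of "s - 1"] by simp
      moreover have "(\<lambda>m. (deriv ^^ m) H 0 / fact m * (s - 1 - 0) ^ m) sums H (s - 1)"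
        by (rule holomorphic_power_series[of _ _ "norm (s - 1) + 1"])
           (use holomorphic_on_subset[OF holH] in auto)
      moreover have "(- 1) ^ m * ((- 1) ^ m * x) = x" for m and x :: complex
        by (simp add: mult.assoc[symmetric] flip: power_mult_distrib)
      ultimately show "(\<lambda>m. (-1) ^ m * g m / fact m * (s - 1) ^ m) sums (riemann_zeta s - 1 / (s - 1))"
        unfolding g by simp
    qed
  qed
  have "stieltjes_gamma = (THE g. P g)" unfolding stieltjes_gamma_def P_def ..
  also have "\<dots> = (\<lambda>m. (- 1) ^ m * (deriv ^^ m) H 0)" unfolding P by (rule the_eq_trivial)
  finally have st: "stieltjes_gamma = (\<lambda>m. (- 1) ^ m * (deriv ^^ m) H 0)" .
  have "(deriv ^^ m) H 0 = (- 1) ^ m * stieltjes_gamma m" for m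
    unfolding st by (simp add: mult.assoc[symmetric] flip: power_mult_distrib)
  then show ?thesis using holH H that by blast
qed

subsection \<open>The generalized digamma function as a limit\<close>

lemma ln_power_growth:
  obtains C where "C \<ge> 0" "\<And>z::complex. norm z \<ge> 1 \<Longrightarrow> norm (ln z) ^ k \<le> C * sqrt (norm z)"
proof
  show "(2 * real k) ^ k * exp (pi / 2) \<ge> 0" by simp
  fix z :: complex assume z: "norm z \<ge> 1"
  then have nz: "z \<noteq> 0" by auto
  \<comment> \<open>Since |ln z| is at most 2y, and y^k at most k^k exp(y), the halving turns exp(y)
    into a multiple of the square root of |z|.\<close>
  define y where "y = (ln (norm z) + pi) / 2"
  have y: "y \<ge> 0" using z by (simp add: y_def)
  have "norm (ln z) \<le> \<bar>Re (ln z)\<bar> + \<bar>Im (ln z)\<bar>" by (rule cmod_le)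
  also have "\<dots> \<le> 2 * y"
    using z nz mpi_less_Im_Ln[OF nz] Im_Ln_le_pi[OF nz] by (simp add: y_def)
  finally have "norm (ln z) ^ k \<le> (2 * y) ^ k" by (rule power_mono) simp
  also have "\<dots> \<le> (2 * real k) ^ k * exp y"
  proof (cases "k = 0")
    case True
    then show ?thesis using y by simp
  next
    case False
    have "y / k \<le> exp (y / k)" using exp_ge_add_one_self[of "y / k"] by linarith
    then have "(y / k) ^ k \<le> exp (y / k) ^ k" using y by (intro power_mono) auto
    also have "\<dots> = exp y" using False by (subst exp_of_nat_mult[symmetric]) simp
    finally have "(2 * real k) ^ k * (y / k) ^ k \<le> (2 * real k) ^ k * exp y"
      by (intro mult_left_mono) auto
    moreover have "(2 * real k) ^ k * (y / k) ^ k = (2 * y) ^ k"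
      using False by (subst power_mult_distrib[symmetric]) simp
    ultimately show ?thesis by simp
  qed
  also have "exp y = exp (pi / 2) * sqrt (norm z)"
  proof -
    have "exp (ln (norm z) / 2) = sqrt (norm z)"
      using z by (intro real_sqrt_unique[symmetric]) (auto simp: power2_eq_square simp flip: exp_add)
    moreover have "y = pi / 2 + ln (norm z) / 2" by (simp add: y_def field_simps)
    ultimately show ?thesis by (simp add: exp_add)
  qed
  finally show "norm (ln z) ^ k \<le> (2 * real k) ^ k * exp (pi / 2) * sqrt (norm z)" by (simp add: mult_ac)
qed

definition log_quot :: "nat \<Rightarrow> complex \<Rightarrow> complex" where
  "log_quot k z = ln z ^ k / z"

definition log_prim :: "nat \<Rightarrow> complex \<Rightarrow> complex" where
  "log_prim k z = ln z ^ (k + 1) / of_nat (k + 1)"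

text \<open>For k = 0 the exponent \<open>k - 1\<close> is truncated to 0, which is harmless because
  the factor \<open>of_nat k\<close> vanishes.\<close>

definition log_quot_deriv :: "nat \<Rightarrow> complex \<Rightarrow> complex" where
  "log_quot_deriv k z = (of_nat k * ln z ^ (k - 1) - ln z ^ k) / z ^ 2"

lemma has_field_derivative_log_prim:
  assumes "z \<notin> \<real>\<^sub>\<le>\<^sub>0"
  shows "(log_prim k has_field_derivative log_quot k z) (at z within A)"
proof -
  have "((\<lambda>z. ln z ^ Suc k / of_nat (Suc k)) has_field_derivative
      (1 + of_nat k) * (inverse z * ln z ^ k) / of_nat (Suc k)) (at z within A)"
    by (intro DERIV_cdivide DERIV_power_Suc has_field_derivative_at_within[OF has_field_derivative_Ln] assms)
  also have "(1 + of_nat k) * (inverse z * ln z ^ k) / of_nat (Suc k) = log_quot k z"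
    unfolding log_quot_def of_nat_Suc[symmetric]
    by (subst nonzero_mult_div_cancel_left) (simp_all add: field_simps del: of_nat_Suc)
  finally show ?thesis unfolding log_prim_def [abs_def] by simp
qed

lemma has_field_derivative_log_quot:
  assumes "z \<notin> \<real>\<^sub>\<le>\<^sub>0"
  shows "(log_quot k has_field_derivative log_quot_deriv k z) (at z within A)"
proof -
  have "z \<noteq> 0" using assms by auto
  then show ?thesis unfolding log_quot_def [abs_def] log_quot_deriv_def
    using assms by (auto intro!: derivative_eq_intros simp: field_simps power2_eq_square)
qed

text \<open>Powers of the logarithm cost at most a square root, so 1/z and 1/z^2 become the
  exponents -1/2 and -3/2: the first still tends to 0, the second is still summable.\<close>

lemma log_quot_bounds:
  obtains C where "C \<ge> 0"
    "\<And>z. norm z \<ge> 1 \<Longrightarrow> norm (log_quot k z) \<le> C * norm z powr (-1/2)"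
    "\<And>z. norm z \<ge> 1 \<Longrightarrow> norm (log_quot_deriv k z) \<le> C * norm z powr (-3/2)"
proof -
  obtain C1 where C1: "C1 \<ge> 0" "\<And>z::complex. norm z \<ge> 1 \<Longrightarrow> norm (ln z) ^ k \<le> C1 * sqrt (norm z)"
    by (rule ln_power_growth) blast
  obtain C2 where C2: "C2 \<ge> 0" "\<And>z::complex. norm z \<ge> 1 \<Longrightarrow> norm (ln z) ^ (k - 1) \<le> C2 * sqrt (norm z)"
    using ln_power_growth by blast
  have p: "sqrt r / r = r powr (-1/2)" "sqrt r / r ^ 2 = r powr (-3/2)" if "r \<ge> 1" for r :: real
  proof -
    have "r powr (1/2) / r powr 1 = r powr (1/2 - 1)" "r powr (1/2) / r powr 2 = r powr (1/2 - 2)"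
      by (rule powr_diff[symmetric])+
    then show "sqrt r / r = r powr (-1/2)" "sqrt r / r ^ 2 = r powr (-3/2)"
      using that by (simp_all add: powr_half_sqrt)
  qed
  show ?thesis
  proof (rule that[of "C1 + real k * C2"])
    show "C1 + real k * C2 \<ge> 0" using C1(1) C2(1) by simp
    fix z :: complex assume z: "norm z \<ge> 1"
    have "norm (log_quot k z) \<le> C1 * sqrt (norm z) / norm z"
      unfolding log_quot_def norm_divide norm_power using z C1(2) by (intro divide_right_mono) auto
    also have "\<dots> = C1 * norm z powr (-1/2)" using p(1)[OF z] by (metis times_divide_eq_right)
    also have "\<dots> \<le> (C1 + real k * C2) * norm z powr (-1/2)"
      using C2(1) by (intro mult_right_mono) auto
    finally show "norm (log_quot k z) \<le> (C1 + real k * C2) * norm z powr (-1/2)" .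
    have "norm (log_quot_deriv k z) \<le> (norm (of_nat k * ln z ^ (k - 1)) + norm (ln z ^ k)) / norm z ^ 2"
      unfolding log_quot_deriv_def norm_divide norm_power[of z] by (intro divide_right_mono norm_triangle_ineq4) auto
    also have "\<dots> \<le> (real k * (C2 * sqrt (norm z)) + C1 * sqrt (norm z)) / norm z ^ 2"
      unfolding norm_mult norm_power norm_of_nat
      by (intro divide_right_mono add_mono mult_left_mono C1 C2 z) auto
    also have "\<dots> = (C1 + real k * C2) * (sqrt (norm z) / norm z ^ 2)"
      by (simp add: algebra_simps add_divide_distrib)
    finally show "norm (log_quot_deriv k z) \<le> (C1 + real k * C2) * norm z powr (-3/2)"
      unfolding p(2)[OF z] .
  qed
qed

lemma filterlim_norm_add_of_nat:
  "filterlim (\<lambda>n. norm (a + of_nat n :: complex)) at_top sequentially"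
proof (rule filterlim_at_top_mono)
  show "filterlim (\<lambda>n. - norm a + real n) at_top sequentially"
    by (intro filterlim_tendsto_add_at_top[OF tendsto_const] filterlim_real_sequentially)
  show "\<forall>\<^sub>F n in sequentially. - norm a + real n \<le> norm (a + of_nat n)"
    using norm_triangle_ineq2[of "of_nat _" "- a"] by (auto simp: add.commute)
qed

lemma tendsto_log_quot_shift: "(\<lambda>n. log_quot k (a + of_nat n)) \<longlonglongrightarrow> 0"
proof -
  obtain C where C: "\<And>z. norm z \<ge> 1 \<Longrightarrow> norm (log_quot k z) \<le> C * norm z powr (-1/2)"
    by (rule log_quot_bounds[of k]) blast
  note lim = filterlim_norm_add_of_nat[of a]
  show ?thesis
  proof (rule Lim_null_comparison)
    show "\<forall>\<^sub>F n in sequentially. norm (log_quot k (a + of_nat n)) \<le> C * norm (a + of_nat n) powr (-1/2)"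
      using filterlim_at_top[THEN iffD1, OF lim, rule_format, of 1] by eventually_elim (rule C)
    show "(\<lambda>n. C * norm (a + of_nat n) powr (-1/2)) \<longlonglongrightarrow> 0"
      using tendsto_mult_right_zero[OF tendsto_neg_powr[OF _ lim, of "-1/2"]] by simp
  qed
qed

text \<open>Needed because \<open>gen_psi\<close> is normalized by the logarithm of n, whereas a
  trapezoid sum starting at a ends with the logarithm of a + n. Both points lie in the half-plane Re
  z >= n - |a|, where the derivative \<open>log_quot k\<close> is small.\<close>

lemma tendsto_log_prim_shift: "(\<lambda>n. log_prim k (a + of_nat n) - log_prim k (of_nat n)) \<longlonglongrightarrow> 0"
proof -
  obtain C where C: "C \<ge> 0" "\<And>z. norm z \<ge> 1 \<Longrightarrow> norm (log_quot k z) \<le> C * norm z powr (-1/2)"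
    by (rule log_quot_bounds[of k]) blast
  have lim: "filterlim (\<lambda>n. - norm a + real n) at_top sequentially"
    by (intro filterlim_tendsto_add_at_top[OF tendsto_const] filterlim_real_sequentially)
  show ?thesis
  proof (rule Lim_null_comparison)
    show "\<forall>\<^sub>F n in sequentially. norm (log_prim k (a + of_nat n) - log_prim k (of_nat n))
        \<le> C * (- norm a + real n) powr (-1/2) * norm a"
      using filterlim_at_top[THEN iffD1, OF lim, rule_format, of 1]
    proof eventually_elim
      case (elim n)
      define S where "S = {z. Re z \<ge> - norm a + real n}"
      have S: "norm z \<ge> - norm a + real n" "z \<notin> \<real>\<^sub>\<le>\<^sub>0" if "z \<in> S" for z
        using that elim complex_Re_le_cmod[of z] by (auto simp: S_def complex_nonpos_Reals_iff)
      have "norm (log_prim k (a + of_nat n) - log_prim k (of_nat n))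
          \<le> C * (- norm a + real n) powr (-1/2) * norm (a + of_nat n - of_nat n)"
      proof (rule field_differentiable_bound)
        show "convex S" unfolding S_def by (rule convex_halfspace_Re_ge)
        show "(log_prim k has_field_derivative log_quot k z) (at z within S)" if "z \<in> S" for z
          by (rule has_field_derivative_log_prim) (rule S(2)[OF that])
        show "norm (log_quot k z) \<le> C * (- norm a + real n) powr (-1/2)" if "z \<in> S" for z
        proof -
          have "norm (log_quot k z) \<le> C * norm z powr (-1/2)"
            using C(2) S(1)[OF that] elim by auto
          also have "\<dots> \<le> C * (- norm a + real n) powr (-1/2)"
            using S(1)[OF that] elim C(1) by (intro mult_left_mono powr_mono2') auto
          finally show ?thesis .
        qed
      qed (use abs_Re_le_cmod[of a] in \<open>auto simp: S_def\<close>)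
      then show ?case by simp
    qed
    show "(\<lambda>n. C * (- norm a + real n) powr (-1/2) * norm a) \<longlonglongrightarrow> 0"
      by (intro tendsto_mult_left_zero tendsto_mult_right_zero tendsto_neg_powr lim) auto
  qed
qed

text \<open>Bounds the logarithm of the quotient of consecutive approximants of
  \<open>gen_Gamma\<close>. In the first-order expansions at n the terms linear in x cancel, and two
  second-order remainders are left, at n - 1 and at n + x; they give \<open>B\<close> and
  \<open>B ^ 2\<close>. The condition on n puts both points into Re z >= n/2 and makes n/2 at least
  1.\<close>

lemma log_prim_increment_bound:
  obtains C where "\<And>n B x. B \<ge> 0 \<Longrightarrow> norm x \<le> B \<Longrightarrow> real n \<ge> 2 * B + 3 \<Longrightarrow>
     norm ((log_prim k (of_nat n) - log_prim k (of_nat n - 1)) * x + log_prim k (of_nat n)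
       - log_prim k (of_nat n + x)) \<le> (B + B ^ 2) * (C * (real n / 2) powr (-3/2))"
proof -
  obtain C where C: "C \<ge> 0" "\<And>z. norm z \<ge> 1 \<Longrightarrow> norm (log_quot_deriv k z) \<le> C * norm z powr (-3/2)"
    by (rule log_quot_bounds[of k]) blast
  have "norm ((log_prim k (of_nat n) - log_prim k (of_nat n - 1)) * x + log_prim k (of_nat n)
       - log_prim k (of_nat n + x)) \<le> (B + B ^ 2) * (C * (real n / 2) powr (-3/2))"
    if B: "B \<ge> 0" "norm x \<le> B" and n: "real n \<ge> 2 * B + 3" for n x B
  proof -
    define S where "S = {z. Re z \<ge> real n / 2}"
    have S: "norm z \<ge> real n / 2" "z \<notin> \<real>\<^sub>\<le>\<^sub>0" if "z \<in> S" for z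
      using that n B complex_Re_le_cmod[of z] by (auto simp: S_def complex_nonpos_Reals_iff)
    define M where "M = C * (real n / 2) powr (-3/2)"
    have M: "M \<ge> 0" using C(1) by (simp add: M_def)
    define e where "e z = log_prim k z - (log_prim k (of_nat n) + log_quot k (of_nat n) * (z - of_nat n))" for z
    have e: "norm (e z) \<le> M * norm (z - of_nat n) ^ 2" if z: "z \<in> S" for z
    proof -
      define f where "f i = (if i = 0 then log_prim k else if i = 1 then log_quot k else log_quot_deriv k)" for i :: nat
      have "norm (f 0 z - (\<Sum>i\<le>1. f i (of_nat n) * (z - of_nat n) ^ i / fact i))
          \<le> M * norm (z - of_nat n) ^ Suc 1 / fact 1"
      proof (rule complex_Taylor[of S])
        show "convex S" unfolding S_def by (rule convex_halfspace_Re_ge)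
        show "(f i has_field_derivative f (Suc i) z) (at z within S)" if "z \<in> S" "i \<le> 1" for i z
          using that has_field_derivative_log_quot has_field_derivative_log_prim S(2)[OF that(1)]
          by (auto simp: f_def)
        show "norm (f (Suc 1) z) \<le> M" if "z \<in> S" for z
        proof -
          have "norm (log_quot_deriv k z) \<le> C * norm z powr (-3/2)"
            using C(2) S(1)[OF that] n B by auto
          also have "\<dots> \<le> C * (real n / 2) powr (-3/2)"
            using S(1)[OF that] n B C(1) by (intro mult_left_mono powr_mono2') auto
          finally show ?thesis by (simp add: f_def M_def)
        qed
        show "of_nat n \<in> S" by (simp add: S_def)
      qed (rule z)
      then show ?thesis by (simp add: f_def e_def power2_eq_square)
    qed
    have 1: "norm (e (of_nat n - 1)) \<le> M" using e[of "of_nat n - 1"] n B by (simp add: S_def)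
    have "of_nat n + x \<in> S" using abs_Re_le_cmod[of x] n B by (simp add: S_def)
    then have "norm (e (of_nat n + x)) \<le> M * norm x ^ 2" using e[of "of_nat n + x"] by simp
    also have "\<dots> \<le> M * B ^ 2" using B M by (intro mult_left_mono power_mono) auto
    finally have 2: "norm (e (of_nat n + x)) \<le> M * B ^ 2" .
    have "(log_prim k (of_nat n) - log_prim k (of_nat n - 1)) * x + log_prim k (of_nat n)
       - log_prim k (of_nat n + x) = - (e (of_nat n - 1) * x) - e (of_nat n + x)"
      by (simp add: e_def algebra_simps)
    also have "norm \<dots> \<le> norm (e (of_nat n - 1)) * norm x + norm (e (of_nat n + x))"
      by (metis norm_minus_cancel norm_mult norm_triangle_ineq4)
    also have "\<dots> \<le> M * B + M * B ^ 2"
      using 1 2 B M by (intro add_mono mult_mono) auto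
    finally show ?thesis by (simp add: M_def algebra_simps)
  qed
  then show ?thesis by (rule that)
qed

text \<open>Explicit logarithms of the approximants of \<open>gen_Gamma\<close> converge uniformly
  near x. Hence \<open>gen_Gamma\<close> is the exponential of a holomorphic limit there, no branch
  of its logarithm has to be chosen, and the derivatives converge too.\<close>

lemma gen_psi_limit:
  assumes x: "x \<notin> \<real>\<^sub>\<le>\<^sub>0"
  shows "(\<lambda>n. log_prim k (of_nat n) - (\<Sum>j=0..n. log_quot k (of_nat j + x))) \<longlonglongrightarrow> gen_psi k x"
proof -
  have "open (- \<real>\<^sub>\<le>\<^sub>0 :: complex set)" by (simp add: open_Compl)
  with x obtain r where r: "r > 0" "ball x r \<subseteq> - \<real>\<^sub>\<le>\<^sub>0"
    by (meson ComplI open_contains_ball)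
  define A where "A = ball x r"
  have shift: "of_nat j + y \<notin> \<real>\<^sub>\<le>\<^sub>0" if "y \<in> A" for j y
    using that r by (force simp: A_def complex_nonpos_Reals_iff)
  define L where "L n y = log_prim k (of_nat n) * y + (\<Sum>j=1..n. log_prim k (of_nat j))
     - (\<Sum>j=0..n. log_prim k (of_nat j + y))" for n y
  \<comment> \<open>The increment from \<open>L i\<close> to \<open>L (Suc i)\<close>, which turns
    the sequence into a series for the M-test.\<close>
  define l where "l i y = (log_prim k (of_nat (Suc i)) - log_prim k (of_nat (Suc i) - 1)) * y +
     log_prim k (of_nat (Suc i)) - log_prim k (of_nat (Suc i) + y)" for i y
  have L_eq: "L n y = (log_prim k 0 * y - log_prim k y) + (\<Sum>i<n. l i y)" for n y
  proof (induction n)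
    case 0
    show ?case by (simp add: L_def)
  next
    case (Suc n)
    have "L (Suc n) y = L n y + l n y" by (simp add: L_def l_def algebra_simps)
    with Suc show ?case by simp
  qed
  define B where "B = norm x + r"
  have B: "norm y \<le> B" if "y \<in> A" for y
    using that norm_triangle_ineq2[of y x] by (auto simp: A_def B_def dist_norm norm_minus_commute)
  obtain C where C: "\<And>n B x. B \<ge> 0 \<Longrightarrow> norm x \<le> B \<Longrightarrow> real n \<ge> 2 * B + 3 \<Longrightarrow>
     norm ((log_prim k (of_nat n) - log_prim k (of_nat n - 1)) * x + log_prim k (of_nat n)
       - log_prim k (of_nat n + x)) \<le> (B + B ^ 2) * (C * (real n / 2) powr (-3/2))"
    by (rule log_prim_increment_bound[of k]) blast
  define g where "g y = (log_prim k 0 * y - log_prim k y) + (\<Sum>i. l i y)" for y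
  have "uniform_limit A (\<lambda>n y. \<Sum>i<n. l i y) (\<lambda>y. \<Sum>i. l i y) sequentially"
  proof (rule Weierstrass_m_test_ev)
    show "\<forall>\<^sub>F n in sequentially. \<forall>y\<in>A. norm (l n y) \<le> (B + B ^ 2) * (C * (real (Suc n) / 2) powr (-3/2))"
      using eventually_ge_at_top[of "nat \<lceil>2 * B + 3\<rceil>"]
    proof eventually_elim
      case (elim n)
      have B0: "B \<ge> 0" using r by (simp add: B_def)
      have "real (Suc n) \<ge> 2 * B + 3" using elim by linarith
      then show ?case unfolding l_def using C[OF B0 B] by blast
    qed
    have "(\<lambda>n. (B + B ^ 2) * (C * (real (Suc n) / 2) powr (-3/2))) =
       (\<lambda>n. ((B + B ^ 2) * C / 2 powr (-3/2)) * real (Suc n) powr (- (3/2)))"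
      by (auto simp: powr_divide simp del: of_nat_Suc)
    then show "summable (\<lambda>n. (B + B ^ 2) * (C * (real (Suc n) / 2) powr (-3/2)))"
      by (simp only:) (intro summable_mult summable_Suc_powr, simp)
  qed
  then have ul: "uniform_limit A L g sequentially"
    unfolding L_eq [abs_def] g_def [abs_def] by (intro uniform_limit_intros)
  have dL: "(L n has_field_derivative (log_prim k (of_nat n) - (\<Sum>j=0..n. log_quot k (of_nat j + y)))) (at y)"
    if "y \<in> A" for n y
  proof -
    have "((\<lambda>y. log_prim k (of_nat j + y)) has_field_derivative log_quot k (of_nat j + y)) (at y)" for j
      using has_field_derivative_log_prim[OF shift[OF that], of k j UNIV]
        DERIV_shift[of "log_prim k" _ y "of_nat j"] by (simp add: add.commute)
    then show ?thesis
      unfolding L_def [abs_def] by (auto intro!: derivative_eq_intros)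
  qed
  have xA: "x \<in> A" and opA: "open A" using r by (auto simp: A_def)
  have holL: "L n holomorphic_on A" for n
    using dL opA by (auto simp: holomorphic_on_open)
  have g': "(\<lambda>n. deriv (L n) x) \<longlonglongrightarrow> deriv g x"
    by (rule deriv_complex_uniform_limit[OF ul _ _ opA xA]) (auto intro: always_eventually holL)
  have holg: "g holomorphic_on A"
  proof (rule holomorphic_uniform_sequence[OF opA holL])
    show "\<exists>d>0. cball y d \<subseteq> A \<and> uniform_limit (cball y d) L g sequentially" if "y \<in> A" for y
      using opA that uniform_limit_on_subset[OF ul] unfolding open_contains_cball by meson
  qed
  have Gamma_eq: "gen_Gamma k y = exp (g y)" if "y \<in> A" for y
  proof -
    have "(\<lambda>n. exp (L n y)) \<longlonglongrightarrow> exp (g y)"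
      by (intro tendsto_exp tendsto_uniform_limitI[OF ul that])
    moreover have "exp (L n y) = exp (ln (of_nat n) ^ (k + 1) / of_nat (k + 1) * y) *
     (\<Prod>j=1..n. exp (ln (of_nat j) ^ (k + 1) / of_nat (k + 1))) /
     (\<Prod>j=0..n. exp (ln (of_nat j + y) ^ (k + 1) / of_nat (k + 1)))" for n
      unfolding L_def log_prim_def by (simp only: exp_diff exp_add exp_sum finite_atLeastAtMost)
    ultimately show ?thesis unfolding gen_Gamma_def by (simp only: limI)
  qed
  have "((\<lambda>y. exp (g y)) has_field_derivative exp (g x) * deriv g x) (at x)"
    using holomorphic_derivI[OF holg opA xA] by (auto intro!: derivative_eq_intros)
  then have "(gen_Gamma k has_field_derivative exp (g x) * deriv g x) (at x)"
    by (rule has_field_derivative_transform_within_open[OF _ opA xA]) (simp add: Gamma_eq)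
  then have "gen_psi k x = deriv g x"
    unfolding gen_psi_def using Gamma_eq[OF xA] by (simp add: DERIV_imp_deriv)
  moreover have "deriv (L n) x = log_prim k (of_nat n) - (\<Sum>j=0..n. log_quot k (of_nat j + x))" for n
    using dL[OF xA] by (rule DERIV_imp_deriv)
  ultimately show ?thesis using g' by simp
qed

subsection \<open>Trapezoid errors of powers\<close>

text \<open>If a > 0, a real value of a x + b forces x to be real, hence positive, and then the
  value is positive.\<close>

lemma cone_not_nonpos:
  fixes x :: complex
  assumes "x \<notin> \<real>\<^sub>\<le>\<^sub>0" "a \<ge> 0" "b \<ge> 0" "a + b > 0"
  shows "of_real a * x + of_real b \<notin> \<real>\<^sub>\<le>\<^sub>0"
proof
  assume "of_real a * x + of_real b \<in> \<real>\<^sub>\<le>\<^sub>0"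
  then have *: "a * Re x + b \<le> 0" "a * Im x = 0" by (auto simp: complex_nonpos_Reals_iff)
  show False
  proof (cases "a = 0")
    case False
    then have "Re x > 0" using * assms(1) by (auto simp: complex_nonpos_Reals_iff)
    then show False using * assms False by (metis add_nonneg_nonneg add_pos_nonneg mult_pos_pos less_eq_real_def not_less)
  qed (use * assms in auto)
qed

text \<open>Compactness and scaling: the segment from x to 1 avoids 0, so its least modulus is
  positive, and dividing a x + b by a + b gives a point of it. The endpoint 1 shows that this
  modulus is at most 1.\<close>

lemma cone_norm_bound:
  fixes x :: complex
  assumes x: "x \<notin> \<real>\<^sub>\<le>\<^sub>0"
  obtains c where "c > 0" "c \<le> 1"
    "\<And>a b. a \<ge> 0 \<Longrightarrow> b \<ge> 0 \<Longrightarrow> c * (a + b) \<le> norm (of_real a * x + of_real b)"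
proof -
  obtain w where w: "w \<in> closed_segment x 1" "\<And>v. v \<in> closed_segment x 1 \<Longrightarrow> norm w \<le> norm v"
    using distance_attains_inf[of "closed_segment x 1" 0] by auto
  obtain t where t: "0 \<le> t" "t \<le> 1" "w = (1 - t) *\<^sub>R x + t *\<^sub>R 1"
    using w(1) by (auto simp: in_segment)
  have "w \<notin> \<real>\<^sub>\<le>\<^sub>0"
    using cone_not_nonpos[OF x, of "1 - t" t] t by (simp add: scaleR_conv_of_real)
  then have "w \<noteq> 0" by auto
  moreover have "norm w \<le> 1" using w(2)[of 1] by simp
  moreover have "norm w * (a + b) \<le> norm (of_real a * x + of_real b)" if "a \<ge> 0" "b \<ge> 0" for a b
  proof (cases "a + b = 0")
    case False
    then have ab: "a + b > 0" using that by simp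
    define v where "v = (1 - b / (a + b)) *\<^sub>R x + (b / (a + b)) *\<^sub>R 1"
    have "1 - b / (a + b) = a / (a + b)" using ab by (simp add: field_simps)
    then have "(of_real (a + b)) * v = of_real a * x + of_real b"
      unfolding v_def using False by (simp add: scaleR_conv_of_real field_simps flip: of_real_add)
    then have "norm (of_real a * x + of_real b) = (a + b) * norm v"
      using ab by (metis norm_mult norm_of_real abs_of_pos)
    moreover have "v \<in> closed_segment x 1"
      unfolding v_def in_segment using that ab by (intro exI[of _ "b / (a + b)"]) auto
    ultimately show ?thesis using w(2) ab by (simp add: mult.commute)
  qed simp
  ultimately show ?thesis using that[of "norm w"] by simp
qed

text \<open>
  The parameter u stands for s - 1, so that the point of expansion s = 1 becomes u = 0.
\<close>

definition inv_powr :: "complex \<Rightarrow> complex \<Rightarrow> complex" where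
  "inv_powr u z = exp (- (1 + u) * ln z)"

text \<open>A primitive in z of \<open>inv_powr u\<close>, normalized to vanish at z = 1. This
  constant of integration makes the singularity at u = 0 removable.\<close>

definition inv_powr_prim :: "complex \<Rightarrow> complex \<Rightarrow> complex" where
  "inv_powr_prim u z = (if u = 0 then ln z else (1 - exp (- u * ln z)) / u)"

definition trapezoid_error :: "complex \<Rightarrow> complex \<Rightarrow> complex" where
  "trapezoid_error u z = (inv_powr u z + inv_powr u (z + 1)) / 2 -
     (inv_powr_prim u (z + 1) - inv_powr_prim u z)"

lemma has_fps_expansion_inv_powr:
  assumes "z \<noteq> 0"
  shows "(\<lambda>u. inv_powr u z) has_fps_expansion fps_const (1 / z) * fps_exp (- ln z)"
proof -
  have "(\<lambda>u. 1 / z * exp (- ln z * u)) has_fps_expansion fps_const (1 / z) * fps_exp (- ln z)"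
    by (intro fps_expansion_intros)
  also have "(\<lambda>u. 1 / z * exp (- ln z * u)) = (\<lambda>u. inv_powr u z)"
    using assms by (auto simp: inv_powr_def algebra_simps exp_diff exp_add exp_minus field_simps)
  finally show ?thesis .
qed

text \<open>Division by u at a removable singularity, needed for \<open>inv_powr_prim\<close> and
  later for the term in which the poles at u = 0 cancel.\<close>

lemma has_fps_expansion_divide_X:
  fixes F :: "complex fps"
  assumes f: "f has_fps_expansion F" and "fps_nth F 0 = 0"
  shows "(\<lambda>x. if x = 0 then fps_nth F 1 else f x / x) has_fps_expansion fps_shift 1 F"
proof (cases "F = 0")
  case True
  then have "\<forall>\<^sub>F x in nhds 0. (if x = 0 then fps_nth F 1 else f x / x) = 0"
    using f unfolding has_fps_expansion_0_iff[symmetric] by (auto simp: has_fps_expansion_0_iff elim: eventually_mono)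
  then show ?thesis using True by (simp add: has_fps_expansion_0_iff)
next
  case False
  then have "1 \<le> subdegree F" using assms(2) by (auto intro!: subdegree_geI)
  from has_fps_expansion_shift[OF f this refl] show ?thesis by (simp only: power_one_right)
qed

lemma has_fps_expansion_inv_powr_prim:
  "(\<lambda>u. inv_powr_prim u z) has_fps_expansion fps_shift 1 (1 - fps_exp (- ln z))"
proof -
  have "(\<lambda>u. 1 - exp (- ln z * u)) has_fps_expansion (1 - fps_exp (- ln z))"
    by (intro fps_expansion_intros)
  then have "(\<lambda>u. if u = 0 then fps_nth (1 - fps_exp (- ln z)) 1 else (1 - exp (- ln z * u)) / u)
      has_fps_expansion fps_shift 1 (1 - fps_exp (- ln z))"
    by (rule has_fps_expansion_divide_X) simp
  also have "(\<lambda>u. if u = 0 then fps_nth (1 - fps_exp (- ln z)) 1 else (1 - exp (- ln z * u)) / u) = (\<lambda>u. inv_powr_prim u z)"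
    by (auto simp: inv_powr_prim_def mult.commute)
  finally show ?thesis .
qed

lemma holomorphic_inv_powr: "(\<lambda>u. inv_powr u z) holomorphic_on A"
  unfolding inv_powr_def by (intro holomorphic_intros)

lemma holomorphic_inv_powr_prim: "(\<lambda>u. inv_powr_prim u z) holomorphic_on A"
proof -
  have d: "deriv (\<lambda>u. 1 - exp (- u * ln z)) 0 = ln z"
    by (rule DERIV_imp_deriv) (auto intro!: derivative_eq_intros)
  have "(\<lambda>u. if u = 0 then deriv (\<lambda>u. 1 - exp (- u * ln z)) 0 else
      (1 - exp (- u * ln z)) / u - (1 - exp (- 0 * ln z)) / (u - 0)) holomorphic_on UNIV"
    by (rule pole_theorem_open) (auto intro!: holomorphic_intros)
  then have "(\<lambda>u. inv_powr_prim u z) holomorphic_on UNIV"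
    unfolding d by (simp add: inv_powr_prim_def cong: if_cong)
  then show ?thesis by (rule holomorphic_on_subset) simp
qed

lemma holomorphic_trapezoid_error: "(\<lambda>u. trapezoid_error u z) holomorphic_on A"
  unfolding trapezoid_error_def
  by (intro holomorphic_intros holomorphic_inv_powr holomorphic_inv_powr_prim) auto

text \<open>Each derivative in u brings down a factor -ln z. So the powers become the summands of
  the generalized digamma function of order p, and their primitives become those of its
  summands.\<close>

lemma higher_deriv_trapezoid_error:
  assumes "z \<noteq> 0" "z + 1 \<noteq> 0"
  shows "(deriv ^^ p) (\<lambda>u. trapezoid_error u z) 0 =
    (- 1) ^ p * ((log_quot p z + log_quot p (z + 1)) / 2 - (log_prim p (z + 1) - log_prim p z))"
proof -
  define F where "F = (fps_const (1 / z) * fps_exp (- ln z) + fps_const (1 / (z + 1)) * fps_exp (- ln (z + 1))) * fps_const (1 / 2) -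
     (fps_shift 1 (1 - fps_exp (- ln (z + 1))) - fps_shift 1 (1 - fps_exp (- ln z)))"
  have "(\<lambda>u. (inv_powr u z + inv_powr u (z + 1)) * (1 / 2) -
     (inv_powr_prim u (z + 1) - inv_powr_prim u z)) has_fps_expansion F"
    unfolding F_def
    by (intro fps_expansion_intros has_fps_expansion_inv_powr has_fps_expansion_inv_powr_prim assms)
  then have "(\<lambda>u. trapezoid_error u z) has_fps_expansion F" by (simp add: trapezoid_error_def)
  then have "(deriv ^^ p) (\<lambda>u. trapezoid_error u z) 0 = fact p * fps_nth F p"
    by (simp add: fps_nth_fps_expansion)
  also have "fact p * fps_nth F p = 
     (- 1) ^ p * ((log_quot p z + log_quot p (z + 1)) / 2 - (log_prim p (z + 1) - log_prim p z))"
  proof -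
    have q: "fact p * (1 / w * ((- l) ^ p / fact p)) = (- 1) ^ p * (l ^ p / w)" for l w :: complex
      by (simp add: power_minus[of l p])
    have K: "fact p * (- ((- l) ^ Suc p / fact (Suc p))) = (- 1) ^ p * (l ^ Suc p / of_nat (Suc p))" for l :: complex
      unfolding power_Suc power_minus[of l p] fact_Suc by (simp del: of_nat_Suc)
    have nth: "fps_nth F p = (1 / z * ((- ln z) ^ p / fact p) + 1 / (z + 1) * ((- ln (z + 1)) ^ p / fact p)) * (1 / 2) -
       ((- ((- ln (z + 1)) ^ Suc p / fact (Suc p))) - (- ((- ln z) ^ Suc p / fact (Suc p))))"
      by (simp add: F_def del: power_Suc fact_Suc power_minus_Bit0 power_minus_Bit1)
    have d1: "x * ((a + b) * (1 / 2) - (c - d)) = (x * a + x * b) / 2 - (x * c - x * d)"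
      and d2: "(x * a + x * b) / 2 - (x * c - x * d) = x * ((a + b) / 2 - (c - d))" for x a b c d :: complex
      by (simp_all add: algebra_simps add_divide_distrib)
    have "fact p * fps_nth F p =
      (- 1) ^ p * ((log_quot p z + log_quot p (z + 1)) / 2 - (log_prim p (z + 1) - log_prim p z))"
      unfolding nth d1 q K d2 log_quot_def log_prim_def by simp
    then show ?thesis .
  qed
  finally show ?thesis .
qed

text \<open>The principal argument is at most pi in modulus; the exponential factor is its effect
  for a nonreal exponent.\<close>

lemma norm_exp_ln_le:
  assumes "w \<noteq> 0" "\<rho> > 0" "norm w \<ge> \<rho>" "Re v \<ge> 0"
  shows "norm (exp (- v * ln w)) \<le> exp (pi * \<bar>Im v\<bar>) * \<rho> powr (- Re v)"
proof -
  have pi: "\<bar>Im (ln w)\<bar> \<le> pi"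
    using mpi_less_Im_Ln[OF assms(1)] Im_Ln_le_pi[OF assms(1)] by linarith
  have "Im v * Im (ln w) \<le> \<bar>Im v\<bar> * \<bar>Im (ln w)\<bar>"
    unfolding abs_mult[symmetric] by (rule abs_ge_self)
  also have "\<dots> \<le> \<bar>Im v\<bar> * pi" by (rule mult_left_mono[OF pi abs_ge_zero])
  finally have "Im v * Im (ln w) \<le> \<bar>Im v\<bar> * pi" .
  moreover have "Re v * ln (norm w) \<ge> Re v * ln \<rho>"
    using assms by (intro mult_left_mono) auto
  ultimately have "Re (- v * ln w) \<le> pi * \<bar>Im v\<bar> + - Re v * ln \<rho>"
    using assms(1) by (simp add: algebra_simps)
  then show ?thesis
    using assms(2) by (simp add: powr_def flip: exp_add)
qed

text \<open>\<open>f\<close> lists the primitive and its first three derivatives. The second-order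
  expansion of the primitive and the first-order expansion of its derivative cancel in the trapezoid
  rule; their remainders \<open>X\<close> and \<open>Y\<close>, both controlled by the third
  derivative, leave \<open>Y / 2 - X\<close>.\<close>

lemma norm_trapezoid_error_le:
  assumes seg: "\<And>w. w \<in> closed_segment z (z + 1) \<Longrightarrow> w \<notin> \<real>\<^sub>\<le>\<^sub>0 \<and> norm w \<ge> \<rho>"
    and \<rho>: "\<rho> > 0" and u: "Re u \<ge> - 3"
  shows "norm (trapezoid_error u z) \<le>
     norm (1 + u) * norm (2 + u) * (exp (pi * \<bar>Im u\<bar>) * \<rho> powr (- 3 - Re u))"
proof -
  define f where "f i w = (if i = 0 then inv_powr_prim u w else if i = 1 then exp (- (1 + u) * ln w)
     else if i = 2 then - (1 + u) * exp (- (2 + u) * ln w) else (1 + u) * (2 + u) * exp (- (3 + u) * ln w))"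
    for i :: nat and w
  define S where "S = closed_segment z (z + 1)"
  define B where "B = norm (1 + u) * norm (2 + u) * (exp (pi * \<bar>Im u\<bar>) * \<rho> powr (- 3 - Re u))"
  have e: "exp (- (a + 1) * ln w) = exp (- a * ln w) / w" if "w \<noteq> 0" for a w :: complex
    using that by (simp add: algebra_simps exp_diff exp_add exp_minus field_simps)
  have d: "(f i has_field_derivative f (Suc i) w) (at w within S)" if w: "w \<in> S" and i: "i \<le> 2" for i w
  proof -
    have nz: "w \<notin> \<real>\<^sub>\<le>\<^sub>0" using seg w by (auto simp: S_def)
    then have w0: "w \<noteq> 0" by auto
    have E: "((\<lambda>w. exp (- a * ln w)) has_field_derivative - a * exp (- (a + 1) * ln w)) (at w within S)" for a
      using nz w0 unfolding e[OF w0] by (auto intro!: derivative_eq_intros simp: field_simps)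
    consider "i = 0" | "i = 1" | "i = 2" using i by linarith
    then show ?thesis
    proof cases
      case 1
      show ?thesis
      proof (cases "u = 0")
        case True
        then show ?thesis using 1 nz w0
          by (auto simp: f_def [abs_def] inv_powr_prim_def exp_minus intro!: derivative_eq_intros simp: field_simps)
      next
        case False
        have "((\<lambda>w. (1 - exp (- u * ln w)) / u) has_field_derivative (0 - - u * exp (- (u + 1) * ln w)) / u) (at w within S)"
          by (intro DERIV_cdivide DERIV_diff DERIV_const E)
        then show ?thesis using 1 False by (simp add: f_def [abs_def] inv_powr_prim_def add.commute)
      qed
    next
      case 2
      then show ?thesis using E[of "1 + u"] by (simp add: f_def [abs_def] add.commute add.left_commute)
    next
      case 3
      have "((\<lambda>w. - (1 + u) * exp (- (2 + u) * ln w)) has_field_derivative - (1 + u) * (- (2 + u) * exp (- (2 + u + 1) * ln w))) (at w within S)"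
        by (intro DERIV_cmult E)
      moreover have "2 + u + 1 = 3 + u" by simp
      moreover have "f 2 = (\<lambda>w. - (1 + u) * exp (- (2 + u) * ln w))" "f (Suc 2) w = (1 + u) * (2 + u) * exp (- (3 + u) * ln w)"
        by (auto simp: f_def)
      ultimately show ?thesis using 3 by (simp only: mult_minus_left mult_minus_right minus_minus mult.assoc)
    qed
  qed
  have b: "norm (f 3 w) \<le> B" if "w \<in> S" for w
  proof -
    have "norm (exp (- (3 + u) * ln w)) \<le> exp (pi * \<bar>Im (3 + u)\<bar>) * \<rho> powr (- Re (3 + u))"
      using seg[of w] that \<rho> u by (intro norm_exp_ln_le) (auto simp: S_def)
    then show ?thesis unfolding f_def B_def by (simp add: norm_mult mult_left_mono)
  qed
  have ends: "z \<in> S" "z + 1 \<in> S" "convex S" by (auto simp: S_def)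
  have 1: "norm (f 0 (z + 1) - (\<Sum>i\<le>2. f i z * (z + 1 - z) ^ i / fact i)) \<le> B * norm (z + 1 - z) ^ Suc 2 / fact 2"
    by (rule complex_Taylor[of S]) (use d b ends in \<open>auto simp: numeral_3_eq_3\<close>)
  have 2: "norm (f (Suc 0) (z + 1) - (\<Sum>i\<le>1. f (Suc i) z * (z + 1 - z) ^ i / fact i)) \<le> B * norm (z + 1 - z) ^ Suc 1 / fact 1"
    by (rule complex_Taylor[of S _ "\<lambda>i. f (Suc i)"]) (use d b ends in \<open>auto simp: numeral_3_eq_3 numeral_2_eq_2\<close>)
  define X where "X = f 0 (z + 1) - (f 0 z + f 1 z + f 2 z / 2)"
  define Y where "Y = f 1 (z + 1) - (f 1 z + f 2 z)"
  have X: "norm X \<le> B / 2" using 1 by (simp add: X_def numeral_2_eq_2)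
  have Y: "norm Y \<le> B" using 2 by (simp add: Y_def numeral_2_eq_2)
  have "trapezoid_error u z = Y / 2 - X"
    by (simp add: trapezoid_error_def X_def Y_def f_def inv_powr_def field_simps)
  also have "norm \<dots> \<le> norm Y / 2 + norm X"
    using norm_triangle_ineq4[of "Y / 2" X] by (simp add: norm_divide)
  finally show ?thesis using X Y unfolding B_def by linarith
qed

section \<open>Summation of the trapezoid errors over the lattice\<close>

definition trapezoid_sum :: "complex \<Rightarrow> complex \<Rightarrow> complex" where
  "trapezoid_sum u a = (\<Sum>n. trapezoid_error u (a + of_nat n))"

text \<open>The function G at s = 1 + u. The ray m = 0 has no row here; its contribution zeta(s)/2
  is added separately.\<close>

definition trapezoid_lattice_sum :: "complex \<Rightarrow> complex \<Rightarrow> complex" where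
  "trapezoid_lattice_sum u x = (\<Sum>m. trapezoid_sum u (of_nat (Suc m) * x))"

lemma lattice_not_nonpos:
  fixes x :: complex
  assumes "x \<notin> \<real>\<^sub>\<le>\<^sub>0"
  shows "of_nat (Suc m) * x + of_nat n \<notin> \<real>\<^sub>\<le>\<^sub>0"
  using cone_not_nonpos[OF assms, of "real (Suc m)" "real n"] by (simp del: of_nat_Suc)

text \<open>Both m + 1 and n + 1 are at most m + 1 + n. Giving half of the exponent to each
  dominates a double sum by a product of single sums.\<close>

lemma lattice_powr_split:
  assumes "p \<ge> 0"
  shows "(real (Suc m) + real n) powr (- (2 * p)) \<le> real (Suc m) powr (- p) * real (Suc n) powr (- p)"
proof -
  have "(real (Suc m) + real n) powr (- (2 * p)) = (real (Suc m) + real n) powr (- p) * (real (Suc m) + real n) powr (- p)"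
    by (simp flip: powr_add)
  also have "\<dots> \<le> real (Suc m) powr (- p) * real (Suc n) powr (- p)"
    using assms by (intro mult_mono powr_mono2') auto
  finally show ?thesis .
qed

text \<open>On the ball Re u lies between -1/2 and 5/2. The lower end gives the decay 5/2, which is
  twice the summable 5/4; the upper end gives the power -11/2 of the constant c <= 1. The numbers 4,
  5 and 2 bound |1 + u|, |2 + u| and |Im u|.\<close>

lemma trapezoid_error_lattice_bound:
  assumes x: "x \<notin> \<real>\<^sub>\<le>\<^sub>0"
  obtains C where "C \<ge> 0" "\<And>u m n. u \<in> ball 1 (3 / 2) \<Longrightarrow>
    norm (trapezoid_error u (of_nat (Suc m) * x + of_nat n)) \<le>
      C * (real (Suc m) powr (- (5 / 4)) * real (Suc n) powr (- (5 / 4)))"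
proof -
  obtain c where c: "c > 0" "c \<le> 1"
    "\<And>a b. a \<ge> 0 \<Longrightarrow> b \<ge> 0 \<Longrightarrow> c * (a + b) \<le> norm (of_real a * x + of_real b)"
    using cone_norm_bound[OF x] by metis
  define C where "C = 4 * 5 * (exp (pi * 2) * c powr (- 11 / 2))"
  have "norm (trapezoid_error u (of_nat (Suc m) * x + of_nat n)) \<le>
      C * (real (Suc m) powr (- (5 / 4)) * real (Suc n) powr (- (5 / 4)))"
    if u: "u \<in> ball 1 (3 / 2)" for u m n
  proof -
    define z where "z = of_nat (Suc m) * x + of_nat n"
    define t where "t = real (Suc m) + real n"
    have t: "t \<ge> 1" by (simp add: t_def)
    have nu: "norm (u - 1) < 3 / 2" using u by (simp add: dist_norm norm_minus_commute)
    have Re: "- 1 / 2 \<le> Re u" "Re u \<le> 5 / 2" and Im: "\<bar>Im u\<bar> \<le> 2"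
      using nu abs_Re_le_cmod[of "u - 1"] abs_Im_le_cmod[of "u - 1"] by (auto simp: abs_le_iff)
    have n1: "norm (1 + u) \<le> 4" "norm (2 + u) \<le> 5"
      using nu norm_triangle_ineq[of "u - 1" 2] norm_triangle_ineq[of "u - 1" 3] by (auto simp: algebra_simps)
    have "norm (trapezoid_error u z) \<le>
       norm (1 + u) * norm (2 + u) * (exp (pi * \<bar>Im u\<bar>) * (c * t) powr (- 3 - Re u))"
    proof (rule norm_trapezoid_error_le)
      fix w assume "w \<in> closed_segment z (z + 1)"
      then obtain s where s: "0 \<le> s" "s \<le> 1" "w = (1 - s) *\<^sub>R z + s *\<^sub>R (z + 1)"
        by (auto simp: in_segment)
      then have w: "w = of_real (real (Suc m)) * x + of_real (real n + s)"
        by (simp add: z_def scaleR_conv_of_real algebra_simps)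
      have "c * t \<le> c * (real (Suc m) + (real n + s))"
        using s c(1) by (simp add: t_def)
      also have "\<dots> \<le> norm w" unfolding w using s by (intro c(3)) auto
      finally have "c * t \<le> norm w" .
      moreover have "w \<notin> \<real>\<^sub>\<le>\<^sub>0"
        unfolding w by (rule cone_not_nonpos[OF x]) (use s in auto)
      ultimately show "w \<notin> \<real>\<^sub>\<le>\<^sub>0 \<and> c * t \<le> norm w" by blast
    qed (use c t Re in auto)
    also have "\<dots> \<le> 4 * 5 * (exp (pi * 2) * (c powr (- 11 / 2) * t powr (- 5 / 2)))"
    proof (intro mult_mono n1)
      have "(c * t) powr (- 3 - Re u) = c powr (- 3 - Re u) * t powr (- 3 - Re u)"
        using c t by (simp add: powr_mult)
      also have "\<dots> \<le> c powr (- 11 / 2) * t powr (- 5 / 2)"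
      proof (rule mult_mono)
        show "c powr (- 3 - Re u) \<le> c powr (- 11 / 2)"
          by (rule powr_mono') (use c Re in auto)
        show "t powr (- 3 - Re u) \<le> t powr (- 5 / 2)"
        proof (rule powr_mono)
          show "- 3 - Re u \<le> - 5 / 2" using Re(1) by argo
        qed (rule t)
      qed auto
      finally show "(c * t) powr (- 3 - Re u) \<le> c powr (- 11 / 2) * t powr (- 5 / 2)" .
    qed (use Im in auto)
    also have "\<dots> = C * t powr (- (2 * (5 / 4)))" by (simp add: C_def)
    also have "\<dots> \<le> C * (real (Suc m) powr (- (5 / 4)) * real (Suc n) powr (- (5 / 4)))"
      unfolding t_def by (intro mult_left_mono lattice_powr_split) (auto simp: C_def)
    finally show ?thesis by (simp add: z_def)
  qed
  then show ?thesis by (intro that[of C]) (auto simp: C_def)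
qed

lemma summable_Suc_powr_five_quarters: "summable (\<lambda>n. real (Suc n) powr (- (5 / 4)))"
  by (rule summable_Suc_powr) simp

lemma trapezoid_error_partial_sum:
  "(\<Sum>n<N. trapezoid_error u (a + of_nat n)) =
     (\<Sum>j=0..N. inv_powr u (a + of_nat j)) - inv_powr u a / 2 - inv_powr u (a + of_nat N) / 2
     - (inv_powr_prim u (a + of_nat N) - inv_powr_prim u a)"
  by (induction N) (simp_all add: trapezoid_error_def add_divide_distrib algebra_simps)

lemma log_trapezoid_partial_sum:
  "(\<Sum>n<N. (log_quot p (a + of_nat n) + log_quot p (a + of_nat n + 1)) / 2
       - (log_prim p (a + of_nat n + 1) - log_prim p (a + of_nat n))) =
     (\<Sum>j=0..N. log_quot p (of_nat j + a)) - log_quot p a / 2 - log_quot p (a + of_nat N) / 2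
     - (log_prim p (a + of_nat N) - log_prim p a)"
  by (induction N) (simp_all add: add_divide_distrib algebra_simps)

text \<open>The termwise differentiation result is applied twice, to each row and to the series of
  rows. The derivatives at 0 of the row sums are then, up to sign, the summands of
  \<open>frakF0\<close>.\<close>

lemma
  assumes x: "x \<notin> \<real>\<^sub>\<le>\<^sub>0"
  shows holomorphic_trapezoid_lattice_sum:
      "(\<lambda>u. trapezoid_lattice_sum u x) holomorphic_on ball 1 (3 / 2)"
    and higher_deriv_trapezoid_lattice_sum:
      "(deriv ^^ p) (\<lambda>u. trapezoid_lattice_sum u x) 0 = - ((- 1) ^ p * frakF0 (Suc p) x)"
proof -
  define a where "a m = of_nat (Suc m) * x" for m
  let ?U = "ball (1::complex) (3 / 2)"
  obtain C where C: "C \<ge> 0" "\<And>u m n. u \<in> ?U \<Longrightarrow> norm (trapezoid_error u (a m + of_nat n)) \<le>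
      C * (real (Suc m) powr (- (5 / 4)) * real (Suc n) powr (- (5 / 4)))"
    using trapezoid_error_lattice_bound[OF x] unfolding a_def by metis
  define Z where "Z = (\<Sum>n. real (Suc n) powr (- (5 / 4)))"
  have sm: "summable (\<lambda>n. C * (real (Suc m) powr (- (5 / 4)) * real (Suc n) powr (- (5 / 4))))" for m
    by (intro summable_mult summable_Suc_powr_five_quarters)
  have hol1: "(\<lambda>u. trapezoid_sum u (a m)) holomorphic_on ?U" for m
    unfolding trapezoid_sum_def
    by (rule holomorphic_on_suminf[where S = ?U, OF open_ball holomorphic_trapezoid_error C(2) sm])
  have sums1: "(\<lambda>n. (deriv ^^ p) (\<lambda>u. trapezoid_error u (a m + of_nat n)) 0) sums
      (deriv ^^ p) (\<lambda>u. trapezoid_sum u (a m)) 0" for m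
    unfolding trapezoid_sum_def
    by (rule higher_deriv_sums[where S = ?U, OF open_ball holomorphic_trapezoid_error C(2) sm]) simp_all
  have bound2: "norm (trapezoid_sum u (a m)) \<le> C * Z * real (Suc m) powr (- (5 / 4))" if "u \<in> ?U" for u m
  proof -
    have "norm (trapezoid_sum u (a m)) \<le> (\<Sum>n. C * (real (Suc m) powr (- (5 / 4)) * real (Suc n) powr (- (5 / 4))))"
      unfolding trapezoid_sum_def by (rule norm_suminf_le[OF C(2)[OF that] sm])
    also have "\<dots> = C * Z * real (Suc m) powr (- (5 / 4))"
      unfolding Z_def mult.assoc[symmetric] suminf_mult[OF summable_Suc_powr_five_quarters] by (simp only: mult_ac)
    finally show ?thesis .
  qed
  have sm2: "summable (\<lambda>m. C * Z * real (Suc m) powr (- (5 / 4)))"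
    by (intro summable_mult summable_Suc_powr_five_quarters)
  have lattice: "trapezoid_lattice_sum u x = (\<Sum>m. trapezoid_sum u (a m))" for u
    by (simp add: trapezoid_lattice_sum_def a_def)
  show "(\<lambda>u. trapezoid_lattice_sum u x) holomorphic_on ?U"
    unfolding lattice
    by (rule holomorphic_on_suminf[where S = ?U, OF open_ball hol1 bound2 sm2])
  have sums2: "(\<lambda>m. (deriv ^^ p) (\<lambda>u. trapezoid_sum u (a m)) 0) sums
      (deriv ^^ p) (\<lambda>u. trapezoid_lattice_sum u x) 0"
    unfolding lattice
    by (rule higher_deriv_sums[where S = ?U, OF open_ball hol1 bound2 sm2]) simp_all
  define T where "T m = gen_psi p (a m) + log_quot p (a m) / 2 - log_prim p (a m)" for m
  have a: "a m + of_nat n \<notin> \<real>\<^sub>\<le>\<^sub>0" for m n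
    unfolding a_def by (rule lattice_not_nonpos[OF x])
  have T: "(deriv ^^ p) (\<lambda>u. trapezoid_sum u (a m)) 0 = - ((- 1) ^ p) * T m" for m
  proof -
    have "a m + of_nat n \<noteq> 0" for n using a[of m n] by auto
    then have z: "a m + of_nat n \<noteq> 0" "a m + of_nat n + 1 \<noteq> 0" for n
      by (metis, metis add.assoc of_nat_Suc add.commute)
    have "(\<lambda>N. (\<Sum>n<N. (deriv ^^ p) (\<lambda>u. trapezoid_error u (a m + of_nat n)) 0)) \<longlonglongrightarrow>
      (deriv ^^ p) (\<lambda>u. trapezoid_sum u (a m)) 0"
      using sums1 unfolding sums_def .
    \<comment> \<open>\<open>log_prim p (of_nat N)\<close> is added and subtracted to expose the
      sequence that defines \<open>gen_psi\<close>; what remains with N tends to 0. The half term at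
      the start of the row is the correction term in \<open>frakF0\<close>.\<close>
    moreover have "(\<Sum>n<N. (deriv ^^ p) (\<lambda>u. trapezoid_error u (a m + of_nat n)) 0) =
       - ((- 1) ^ p) * ((log_prim p (of_nat N) - (\<Sum>j=0..N. log_quot p (of_nat j + a m)))
        + log_quot p (a m) / 2 + log_quot p (a m + of_nat N) / 2
        + (log_prim p (a m + of_nat N) - log_prim p (of_nat N)) - log_prim p (a m))" for N
      unfolding higher_deriv_trapezoid_error[OF z] sum_distrib_left[symmetric] log_trapezoid_partial_sum
      by (simp add: algebra_simps)
    moreover have "(\<lambda>N. - ((- 1) ^ p) * ((log_prim p (of_nat N) - (\<Sum>j=0..N. log_quot p (of_nat j + a m)))
        + log_quot p (a m) / 2 + log_quot p (a m + of_nat N) / 2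
        + (log_prim p (a m + of_nat N) - log_prim p (of_nat N)) - log_prim p (a m)))
      \<longlonglongrightarrow> - ((- 1) ^ p) * (gen_psi p (a m) + log_quot p (a m) / 2 + 0 / 2 + 0 - log_prim p (a m))"
      using a[of m 0] by (intro tendsto_intros gen_psi_limit tendsto_log_quot_shift tendsto_log_prim_shift) auto
    ultimately show ?thesis
      unfolding T_def by (simp only: LIMSEQ_unique) (simp add: LIMSEQ_unique)
  qed
  have "(\<lambda>m. - ((- 1) ^ p) * (- ((- 1) ^ p) * T m)) sums (- ((- 1) ^ p) * (deriv ^^ p) (\<lambda>u. trapezoid_lattice_sum u x) 0)"
    using sums_mult[OF sums2] unfolding T .
  then have "T sums (- ((- 1) ^ p) * (deriv ^^ p) (\<lambda>u. trapezoid_lattice_sum u x) 0)"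
    by (simp add: mult.assoc[symmetric] flip: power_mult_distrib)
  then have "suminf T = - ((- 1) ^ p) * (deriv ^^ p) (\<lambda>u. trapezoid_lattice_sum u x) 0"
    by (rule sums_unique[symmetric])
  moreover have "suminf T = frakF0 (Suc p) x"
    unfolding frakF0_def T_def a_def log_quot_def log_prim_def Let_def
    by (intro suminf_cong) (simp add: mult_ac)
  ultimately show "(deriv ^^ p) (\<lambda>u. trapezoid_lattice_sum u x) 0 = - ((- 1) ^ p * frakF0 (Suc p) x)"
    by (simp add: mult.assoc[symmetric] flip: power_mult_distrib)
qed

subsection \<open>Sums over the positive lattice cone\<close>

text \<open>The sign of Im x puts both points into the same closed half-plane, off the negative
  axis. Their arguments then differ by less than pi, so the difference of logarithms is again
  principal.\<close>

lemma Ln_cone_divide: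
  fixes x :: complex
  assumes x: "x \<notin> \<real>\<^sub>\<le>\<^sub>0" and "a \<ge> 0" "b \<ge> 0" "a + b > 0" "c \<ge> 0" "d \<ge> 0" "c + d > 0"
  defines "v \<equiv> of_real a * x + of_real b" and "y \<equiv> of_real c * x + of_real d"
  shows "ln (v / y) = ln v - ln y"
proof -
  have v: "v \<notin> \<real>\<^sub>\<le>\<^sub>0" "v \<noteq> 0" and y: "y \<notin> \<real>\<^sub>\<le>\<^sub>0" "y \<noteq> 0"
    using cone_not_nonpos[OF x, of a b] cone_not_nonpos[OF x, of c d] assms by auto
  have b: "Im (ln v) < pi" "Im (ln y) < pi" "- pi < Im (ln v)" "- pi < Im (ln y)"
    using Im_Ln_less_pi v y mpi_less_Im_Ln by auto
  have "\<bar>Im (ln v) - Im (ln y)\<bar> < pi"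
  proof (cases "Im x > 0")
    case True
    then have "Im v \<ge> 0" "Im y \<ge> 0" using assms by (auto simp: v_def y_def)
    then have "Im (ln v) \<ge> 0" "Im (ln y) \<ge> 0" using Im_Ln_pos_le v y by auto
    then show ?thesis using b by linarith
  next
    case False
    then have "\<not> Im v > 0" "\<not> Im y > 0"
      using assms by (auto simp: v_def y_def not_less mult_nonneg_nonpos)
    then have "Im (ln v) \<le> 0" "Im (ln y) \<le> 0" using Im_Ln_pos_lt[OF v(2)] Im_Ln_pos_lt[OF y(2)] b by auto
    then show ?thesis using b by linarith
  qed
  then have "ln (exp (ln v - ln y)) = ln v - ln y" by (intro Ln_exp) auto
  then show ?thesis using v y by (simp add: exp_diff)
qed

lemma inv_powr_cone_divide:
  fixes x :: complex
  assumes "x \<notin> \<real>\<^sub>\<le>\<^sub>0" "a \<ge> 0" "b \<ge> 0" "a + b > 0" "c \<ge> 0" "d \<ge> 0" "c + d > 0"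
  shows "inv_powr u (of_real a * x + of_real b) =
    inv_powr u (of_real c * x + of_real d) * inv_powr u ((of_real a * x + of_real b) / (of_real c * x + of_real d))"
  unfolding inv_powr_def Ln_cone_divide[OF assms] by (simp add: algebra_simps flip: exp_add)

lemma ln_nat_mult:
  fixes z :: complex
  assumes "z \<noteq> 0"
  shows "exp (- v * ln (of_nat (Suc m) * z)) = of_nat (Suc m) powr (- v) * exp (- v * ln z)"
proof -
  have "ln (of_nat (Suc m) * z) = ln (of_nat (Suc m)) + ln z"
    by (rule Ln_times_of_nat) (use assms in auto)
  moreover have "of_nat (Suc m) \<noteq> (0 :: complex)" by (rule of_nat_neq_0)
  ultimately show ?thesis
    by (simp only: powr_def if_False distrib_left exp_add)
qed

lemma inv_powr_nat_mult:
  "z \<noteq> 0 \<Longrightarrow> inv_powr u (of_nat (Suc m) * z) = of_nat (Suc m) powr (- (1 + u)) * inv_powr u z"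
  unfolding inv_powr_def by (rule ln_nat_mult)

definition cone_term :: "complex \<Rightarrow> complex \<Rightarrow> nat \<times> nat \<Rightarrow> complex" where
  "cone_term u x = (\<lambda>(m, n). inv_powr u (of_nat (Suc m) * x + of_nat (Suc n)))"

text \<open>An unordered sum, so that it can be reindexed and split along the diagonal. It covers
  the interior of the cone only; the boundary rays are added later with weight 1/2.\<close>

definition cone_sum :: "complex \<Rightarrow> complex \<Rightarrow> complex" where
  "cone_sum u x = infsum (cone_term u x) UNIV"

lemma summable_cone_term:
  assumes x: "x \<notin> \<real>\<^sub>\<le>\<^sub>0" and u: "Re u > 1"
  shows "cone_term u x summable_on UNIV"
proof (rule abs_summable_summable)
  obtain c where c: "c > 0" "c \<le> 1"
    "\<And>a b. a \<ge> 0 \<Longrightarrow> b \<ge> 0 \<Longrightarrow> c * (a + b) \<le> norm (of_real a * x + of_real b)"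
    using cone_norm_bound[OF x] by metis
  \<comment> \<open>Half of the decay exponent 1 + Re u of the terms; it exceeds 1 because Re u >
    1.\<close>
  define p where "p = (1 + Re u) / 2"
  have p: "p > 1" using u by (simp add: p_def)
  define C where "C = exp (pi * \<bar>Im u\<bar>) * c powr (- (1 + Re u))"
  define s where "s = (\<Sum>n. real (Suc n) powr (- p))"
  have hs: "((\<lambda>n. real (Suc n) powr (- p)) has_sum s) UNIV"
    unfolding s_def using summable_Suc_powr[OF p]
    by (intro sums_nonneg_imp_has_sum summable_sums) auto
  have "(\<lambda>(m, n). C * (real (Suc m) powr (- p) * real (Suc n) powr (- p))) summable_on Sigma UNIV (\<lambda>_. UNIV)"
  proof (rule summable_on_SigmaI)
    show "((\<lambda>n. (case (m, n) of (m, n) \<Rightarrow> C * (real (Suc m) powr (- p) * real (Suc n) powr (- p))))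
        has_sum (C * (real (Suc m) powr (- p) * s))) UNIV" for m
      using hs by (auto intro!: has_sum_cmult_right simp del: of_nat_Suc)
    show "(\<lambda>m. C * (real (Suc m) powr (- p) * s)) summable_on UNIV"
      using has_sum_imp_summable[OF hs]
      by (intro summable_on_cmult_right summable_on_cmult_left)
  qed (auto simp: C_def)
  then have sm: "(\<lambda>(m, n). C * (real (Suc m) powr (- p) * real (Suc n) powr (- p))) summable_on UNIV"
    by simp
  have le: "norm (inv_powr u (of_nat (Suc m) * x + of_nat (Suc n)))
      \<le> C * (real (Suc m) powr (- p) * real (Suc n) powr (- p))" for m n
  proof -
    define w where "w = of_real (real (Suc m)) * x + of_real (real (Suc n))"
    have "w \<notin> \<real>\<^sub>\<le>\<^sub>0" unfolding w_def by (rule cone_not_nonpos[OF x]) auto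
    then have w0: "w \<noteq> 0" by auto
    have "c * (real (Suc m) + real n) \<le> c * (real (Suc m) + real (Suc n))" using c(1) by simp
    also have "\<dots> \<le> norm w" unfolding w_def by (intro c(3)) auto
    finally have "norm (inv_powr u w) \<le> exp (pi * \<bar>Im (1 + u)\<bar>) * (c * (real (Suc m) + real n)) powr (- Re (1 + u))"
      unfolding inv_powr_def using u c(1) w0 by (intro norm_exp_ln_le) auto
    also have "\<dots> = C * (real (Suc m) + real n) powr (- (2 * p))"
    proof -
      have "2 * p = 1 + Re u" by (simp add: p_def)
      then show ?thesis using c(1) by (simp add: C_def powr_mult)
    qed
    also have "\<dots> \<le> C * (real (Suc m) powr (- p) * real (Suc n) powr (- p))"
      using p by (intro mult_left_mono lattice_powr_split) (auto simp: C_def)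
    finally show ?thesis by (simp only: w_def of_real_of_nat_eq)
  qed
  show "(\<lambda>p. norm (cone_term u x p)) summable_on UNIV"
    by (rule Infinite_Sum.abs_summable_on_comparison_test'[OF sm])
       (auto simp: cone_term_def le simp del: of_nat_Suc)
qed

lemma tendsto_exp_ln_shift:
  assumes "Re v > 0"
  shows "(\<lambda>n. exp (- v * ln (a + of_nat n))) \<longlonglongrightarrow> 0"
proof (rule Lim_null_comparison)
  note lim = filterlim_norm_add_of_nat[of a]
  show "\<forall>\<^sub>F n in sequentially. norm (exp (- v * ln (a + of_nat n))) \<le>
      exp (pi * \<bar>Im v\<bar>) * norm (a + of_nat n) powr (- Re v)"
    using filterlim_at_top[THEN iffD1, OF lim, rule_format, of 1]
    by eventually_elim (rule norm_exp_ln_le, use assms in auto)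
  show "(\<lambda>n. exp (pi * \<bar>Im v\<bar>) * norm (a + of_nat n) powr (- Re v)) \<longlonglongrightarrow> 0"
    using tendsto_mult_right_zero[OF tendsto_neg_powr[OF _ lim, of "- Re v"]] assms by simp
qed

text \<open>For Re u > 1 the parts of the trapezoid errors converge separately. A row starting at a
  consists of its interior sum, half of its first term and minus the integral a^(-u)/u; with a = (m
  + 1) x, the last two sum over m to the zeta terms.\<close>

lemma trapezoid_lattice_sum_eq_cone_sum:
  assumes x: "x \<notin> \<real>\<^sub>\<le>\<^sub>0" and u: "u \<in> ball 1 (3 / 2)" "Re u > 1"
  shows "trapezoid_lattice_sum u x + exp (- u * ln x) * riemann_zeta u / u
    = cone_sum u x + inv_powr u x * riemann_zeta (1 + u) / 2"
proof -
  define a where "a m = of_nat (Suc m) * x" for m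
  have u0: "u \<noteq> 0" using u by auto
  have x0: "x \<noteq> 0" using x by auto
  define S where "S m = (\<Sum>\<^sub>\<infinity>n. cone_term u x (m, n))" for m
  have S: "((\<lambda>n. cone_term u x (m, n)) has_sum S m) UNIV" for m
  proof -
    have "(\<lambda>(m, n). cone_term u x (m, n)) summable_on Sigma UNIV (\<lambda>_. UNIV)"
      using summable_cone_term[OF x u(2)] by simp
    from summable_on_SigmaD1[OF this, of m] show ?thesis unfolding S_def by simp
  qed
  have row: "trapezoid_sum u (a m) = S m + inv_powr u (a m) / 2 - exp (- u * ln (a m)) / u" for m
  proof -
    have "(\<lambda>n. inv_powr u (a m + of_nat (Suc n))) sums S m"
      using has_sum_imp_sums[OF S[of m]] by (simp add: cone_term_def a_def)
    then have "(\<lambda>N. inv_powr u (a m + of_nat 0) + (\<Sum>n<N. inv_powr u (a m + of_nat (Suc n)))) \<longlonglongrightarrow> inv_powr u (a m) + S m"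
      unfolding sums_def by (auto intro!: tendsto_intros)
    also have "(\<lambda>N. inv_powr u (a m + of_nat 0) + (\<Sum>n<N. inv_powr u (a m + of_nat (Suc n))))
        = (\<lambda>N. \<Sum>j=0..N. inv_powr u (a m + of_nat j))"
      by (rule ext, subst atLeast0AtMost, subst sum.atMost_shift) simp
    finally have 1: "(\<lambda>N. \<Sum>j=0..N. inv_powr u (a m + of_nat j)) \<longlonglongrightarrow> inv_powr u (a m) + S m" .
    have 2: "(\<lambda>N. inv_powr u (a m + of_nat N)) \<longlonglongrightarrow> 0"
      unfolding inv_powr_def by (rule tendsto_exp_ln_shift) (use u in simp)
    have "(\<lambda>N. (1 - exp (- u * ln (a m + of_nat N))) / u) \<longlonglongrightarrow> (1 - 0) / u"
      by (intro tendsto_intros tendsto_exp_ln_shift) (use u u0 in auto)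
    then have 3: "(\<lambda>N. inv_powr_prim u (a m + of_nat N)) \<longlonglongrightarrow> 1 / u"
      using u0 by (simp add: inv_powr_prim_def)
    have "(\<lambda>N. \<Sum>n<N. trapezoid_error u (a m + of_nat n)) \<longlonglongrightarrow>
       inv_powr u (a m) + S m - inv_powr u (a m) / 2 - 0 / 2 - (1 / u - inv_powr_prim u (a m))"
      unfolding trapezoid_error_partial_sum by (intro tendsto_intros 1 2 3) simp
    then have "trapezoid_sum u (a m) = inv_powr u (a m) + S m - inv_powr u (a m) / 2 - 0 / 2 - (1 / u - inv_powr_prim u (a m))"
      unfolding trapezoid_sum_def sums_def[symmetric] by (rule sums_unique[symmetric])
    then show ?thesis using u0 by (simp add: inv_powr_prim_def field_simps)
  qed
  have "(\<lambda>m. S m) sums cone_sum u x"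
  proof (rule has_sum_imp_sums, rule has_sum_SigmaD)
    show "(cone_term u x has_sum cone_sum u x) (Sigma UNIV (\<lambda>_. UNIV))"
      unfolding cone_sum_def using summable_cone_term[OF x u(2)] by simp
  qed (rule S)
  moreover have "(\<lambda>m. of_nat (Suc m) powr (- (1 + u)) * inv_powr u x / 2) sums (riemann_zeta (1 + u) * inv_powr u x / 2)"
  proof -
    have R: "Re (1 + u) > 1" using u by simp
    show ?thesis unfolding riemann_zeta_eq_dirichlet[OF R]
      by (intro sums_divide sums_mult2 dirichlet_zeta_sums R)
  qed
  moreover have "(\<lambda>m. of_nat (Suc m) powr (- u) * exp (- u * ln x) / u) sums (riemann_zeta u * exp (- u * ln x) / u)"
    unfolding riemann_zeta_eq_dirichlet[OF u(2)] by (intro sums_divide sums_mult2 dirichlet_zeta_sums u)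
  ultimately have "(\<lambda>m. S m + of_nat (Suc m) powr (- (1 + u)) * inv_powr u x / 2 - of_nat (Suc m) powr (- u) * exp (- u * ln x) / u)
      sums (cone_sum u x + riemann_zeta (1 + u) * inv_powr u x / 2 - riemann_zeta u * exp (- u * ln x) / u)"
    by (intro sums_add sums_diff)
  moreover have "S m + of_nat (Suc m) powr (- (1 + u)) * inv_powr u x / 2 - of_nat (Suc m) powr (- u) * exp (- u * ln x) / u
      = trapezoid_sum u (of_nat (Suc m) * x)" for m
    using row[of m] unfolding a_def inv_powr_nat_mult[OF x0] ln_nat_mult[OF x0] by simp
  ultimately have "trapezoid_lattice_sum u x =
      cone_sum u x + riemann_zeta (1 + u) * inv_powr u x / 2 - riemann_zeta u * exp (- u * ln x) / u"
    unfolding trapezoid_lattice_sum_def by (simp only: sums_unique[symmetric])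
  then show ?thesis by (simp add: algebra_simps)
qed

lemma cone_sum_reciprocal:
  assumes x: "x \<notin> \<real>\<^sub>\<le>\<^sub>0"
  shows "cone_sum u x = inv_powr u x * cone_sum u (1 / x)"
proof -
  have x0: "x \<noteq> 0" using x by auto
  have "cone_sum u x = (\<Sum>\<^sub>\<infinity>p. inv_powr u x * cone_term u (1 / x) p)"
    unfolding cone_sum_def
  proof (rule infsum_reindex_bij_witness[of _ prod.swap prod.swap])
    fix p :: "nat \<times> nat"
    obtain m n where p: "p = (m, n)" by (cases p)
    have "inv_powr u (of_nat (Suc m) * x + of_nat (Suc n)) =
        inv_powr u x * inv_powr u ((of_nat (Suc m) * x + of_nat (Suc n)) / x)"
      using inv_powr_cone_divide[OF x, of "real (Suc m)" "real (Suc n)" 1 0 u] by (simp del: of_nat_Suc)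
    also have "(of_nat (Suc m) * x + of_nat (Suc n)) / x = of_nat (Suc n) * (1 / x) + of_nat (Suc m)"
      using x0 by (simp add: field_simps)
    finally show "inv_powr u x * cone_term u (1 / x) (prod.swap p) = cone_term u x p"
      by (simp only: p cone_term_def swap_simp case_prod_conv)
  qed auto
  then show ?thesis unfolding cone_sum_def by (simp only: infsum_cmult_right')
qed

text \<open>
  The lattice cone is split along its diagonal: m < n, n < m and m = n give the three summands.
\<close>

lemma cone_sum_three_term:
  assumes x: "x \<notin> \<real>\<^sub>\<le>\<^sub>0" and u: "Re u > 1"
  shows "cone_sum u x = cone_sum u (x + 1) + inv_powr u (x + 1) * cone_sum u (x / (x + 1))
     + inv_powr u (x + 1) * riemann_zeta (1 + u)"
proof -
  have "x + 1 \<notin> \<real>\<^sub>\<le>\<^sub>0" using cone_not_nonpos[OF x, of 1 1] by simp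
  then have x1: "x + 1 \<noteq> 0" by auto
  define A where "A = {(m, n). m < (n::nat)}"
  define B where "B = {(m, n). n < (m::nat)}"
  define D where "D = {(m, n). m = (n::nat)}"
  have sm: "cone_term u x summable_on M" for M
    by (rule summable_on_subset_banach[OF summable_cone_term[OF x u]]) simp
  have "cone_sum u x = infsum (cone_term u x) ((A \<union> B) \<union> D)"
    unfolding cone_sum_def by (rule arg_cong[of _ _ "infsum _"]) (auto simp: A_def B_def D_def)
  also have "\<dots> = infsum (cone_term u x) (A \<union> B) + infsum (cone_term u x) D"
    by (rule infsum_Un_disjoint[OF sm sm]) (auto simp: A_def B_def D_def)
  also have "infsum (cone_term u x) (A \<union> B) = infsum (cone_term u x) A + infsum (cone_term u x) B"
    by (rule infsum_Un_disjoint[OF sm sm]) (auto simp: A_def B_def D_def)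
  also have "infsum (cone_term u x) A = cone_sum u (x + 1)"
    unfolding cone_sum_def
  \<comment> \<open>With n = m + j + 1, the point (m + 1) x + (n + 1) equals (m + 1)(x + 1) + (j +
    1).\<close>
  proof (rule infsum_reindex_bij_witness[of _ "\<lambda>(m, j). (m, m + Suc j)" "\<lambda>(m, n). (m, n - Suc m)"])
    fix p assume "p \<in> A"
    then obtain m n where p: "p = (m, n)" "m < n" by (auto simp: A_def)
    then obtain j where j: "n = m + Suc j" using less_iff_Suc_add by auto
    show "cone_term u (x + 1) (case p of (m, n) \<Rightarrow> (m, n - Suc m)) = cone_term u x p"
      unfolding p j cone_term_def by (simp add: algebra_simps)
  qed (auto simp: A_def)
  also have "infsum (cone_term u x) B = (\<Sum>\<^sub>\<infinity>p. inv_powr u (x + 1) * cone_term u (x / (x + 1)) p)"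
  \<comment> \<open>With m = n + j + 1, the point equals (j + 1) x + (n + 1)(x + 1), from which x +
    1 is factored out.\<close>
  proof (rule infsum_reindex_bij_witness[of _ "\<lambda>(j, n). (n + Suc j, n)" "\<lambda>(m, n). (m - Suc n, n)"])
    fix p assume "p \<in> B"
    then obtain m n where p: "p = (m, n)" "n < m" by (auto simp: B_def)
    then obtain j where j: "m = n + Suc j" using less_iff_Suc_add by auto
    have "inv_powr u (of_nat (Suc m) * x + of_nat (Suc n)) = inv_powr u (x + 1) *
        inv_powr u ((of_nat (Suc m) * x + of_nat (Suc n)) / (x + 1))"
      using inv_powr_cone_divide[OF x, of "real (Suc m)" "real (Suc n)" 1 1 u] by (simp del: of_nat_Suc)
    also have "(of_nat (Suc m) * x + of_nat (Suc n)) / (x + 1) = of_nat (Suc j) * (x / (x + 1)) + of_nat (Suc n)"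
      using x1 unfolding j by (simp add: field_simps)
    finally show "inv_powr u (x + 1) * cone_term u (x / (x + 1)) (case p of (m, n) \<Rightarrow> (m - Suc n, n)) = cone_term u x p"
      unfolding p cone_term_def case_prod_conv by (simp add: j)
  qed (auto simp: B_def)
  also have "\<dots> = inv_powr u (x + 1) * cone_sum u (x / (x + 1))"
    unfolding cone_sum_def by (rule infsum_cmult_right')
  also have "infsum (cone_term u x) D = (\<Sum>\<^sub>\<infinity>m. of_nat (Suc m) powr (- (1 + u)) * inv_powr u (x + 1))"
  proof (rule infsum_reindex_bij_witness[of _ "\<lambda>m. (m, m)" fst])
    fix p assume "p \<in> D"
    then obtain m where p: "p = (m, m)" by (auto simp: D_def)
    have "of_nat (Suc m) * x + of_nat (Suc m) = of_nat (Suc m) * (x + 1)" by (simp add: algebra_simps)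
    then show "of_nat (Suc (fst p)) powr (- (1 + u)) * inv_powr u (x + 1) = cone_term u x p"
      unfolding p cone_term_def case_prod_conv fst_conv by (simp only: inv_powr_nat_mult[OF x1])
  qed (auto simp: D_def)
  also have "\<dots> = riemann_zeta (1 + u) * inv_powr u (x + 1)"
  proof (rule infsumI, rule norm_summable_imp_has_sum)
    have R: "Re (1 + u) > 1" using u by simp
    show "summable (\<lambda>m. norm (of_nat (Suc m) powr (- (1 + u)) * inv_powr u (x + 1)))"
      unfolding norm_mult norm_Suc_powr by (intro summable_mult2 summable_Suc_powr R)
    show "(\<lambda>m. of_nat (Suc m) powr (- (1 + u)) * inv_powr u (x + 1)) sums (riemann_zeta (1 + u) * inv_powr u (x + 1))"
      unfolding riemann_zeta_eq_dirichlet[OF R] by (intro sums_mult2 dirichlet_zeta_sums R)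
  qed
  finally show ?thesis by (simp add: mult.commute)
qed

subsection \<open>The period function and the functional equations\<close>

text \<open>
  At u = 0 the poles of zeta u / u and zeta (1 + u) / 2 cancel, because zeta 0 = - 1 / 2; the point
  u = 1, where zeta u has its pole, is excluded.
\<close>

lemma period_function:
  obtains E :: "complex \<Rightarrow> complex \<Rightarrow> complex" where
    "\<And>x. x \<notin> \<real>\<^sub>\<le>\<^sub>0 \<Longrightarrow> (\<lambda>u. E u x) holomorphic_on ball 1 (3 / 2) - {1}"
    "\<And>x p. x \<notin> \<real>\<^sub>\<le>\<^sub>0 \<Longrightarrow> (deriv ^^ p) (\<lambda>u. E u x) 0 = - calF (Suc p) x"
    "\<And>x u. x \<notin> \<real>\<^sub>\<le>\<^sub>0 \<Longrightarrow> u \<in> ball 1 (3 / 2) \<Longrightarrow> Re u > 1 \<Longrightarrow>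
       E u x = cone_sum u x + riemann_zeta (1 + u) * (1 + inv_powr u x) / 2"
proof -
  obtain H where H: "H holomorphic_on UNIV" "\<And>u. u \<noteq> 0 \<Longrightarrow> riemann_zeta (1 + u) = 1 / u + H u"
    "\<And>m. (deriv ^^ m) H 0 = (- 1) ^ m * stieltjes_gamma m"
    using zeta_laurent by blast
  \<comment> \<open>The summand 1/2 becomes 1/(2u) after division by u: it is the polar part of
    zeta(1 + u)/2. Since zeta(0) = -1/2, \<open>g x\<close> vanishes at 0 and the quotient is
    regular there.\<close>
  define g where "g x u = exp (- ln x * u) * riemann_zeta u + 1 / 2" for x u
  define G where "G x = fps_exp (- ln x) * fps_expansion riemann_zeta 0 + fps_const (1 / 2)" for x
  have g: "g x has_fps_expansion G x" for x
    unfolding g_def [abs_def] G_def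
    by (intro fps_expansion_intros has_fps_expansion_fps_expansion[of "-{1}"] holomorphic_riemann_zeta) auto
  have G0: "fps_nth (G x) 0 = 0" for x
    by (simp add: G_def fps_expansion_def riemann_zeta_0)
  define Q where "Q x u = (if u = 0 then fps_nth (G x) 1 else g x u / u)" for x u
  have Q: "Q x has_fps_expansion fps_shift 1 (G x)" for x
    unfolding Q_def [abs_def] by (rule has_fps_expansion_divide_X[OF g G0])
  have holg: "g x holomorphic_on -{1}" for x
    unfolding g_def [abs_def] by (intro holomorphic_intros holomorphic_riemann_zeta) auto
  have g0: "g x 0 = 0" for x by (simp add: g_def riemann_zeta_0)
  have holQ: "Q x holomorphic_on -{1}" for x
  proof -
    have d: "deriv (g x) 0 = fps_nth (G x) 1"
      using fps_nth_fps_expansion[OF g, of x 1] by simp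
    have "(\<lambda>u. if u = 0 then deriv (g x) 0 else g x u / u - g x 0 / (u - 0)) holomorphic_on -{1}"
      by (rule pole_theorem_open[OF holg]) auto
    then show ?thesis unfolding Q_def [abs_def] by (simp only: d g0 div_0 diff_zero)
  qed
  define E where "E u x = trapezoid_lattice_sum u x + Q x u + H u * (1 / 2)" for u x
  show ?thesis
  proof (rule that[of E])
    fix x :: complex assume x: "x \<notin> \<real>\<^sub>\<le>\<^sub>0"
    note holT = holomorphic_trapezoid_lattice_sum[OF x]
    show "(\<lambda>u. E u x) holomorphic_on ball 1 (3 / 2) - {1}"
      unfolding E_def
      by (intro holomorphic_intros holomorphic_on_subset[OF holT] holomorphic_on_subset[OF holQ]
          holomorphic_on_subset[OF H(1)]) auto
    show "E u x = cone_sum u x + riemann_zeta (1 + u) * (1 + inv_powr u x) / 2"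
      if u: "u \<in> ball 1 (3 / 2)" "Re u > 1" for u
    proof -
      have u0: "u \<noteq> 0" using u by auto
      have "E u x = (trapezoid_lattice_sum u x + exp (- u * ln x) * riemann_zeta u / u) + (1 / u + H u) / 2"
        using u0 by (simp add: E_def Q_def g_def add_divide_distrib mult.commute)
      then show ?thesis
        unfolding trapezoid_lattice_sum_eq_cone_sum[OF x u] H(2)[OF u0, symmetric]
        by (simp add: algebra_simps add_divide_distrib)
    qed
    show "(deriv ^^ p) (\<lambda>u. E u x) 0 = - calF (Suc p) x" for p
    proof -
      let ?T = "fps_expansion (\<lambda>u. trapezoid_lattice_sum u x) 0"
      have T: "(\<lambda>u. trapezoid_lattice_sum u x) has_fps_expansion ?T"
        by (rule has_fps_expansion_fps_expansion[OF open_ball _ holT]) simp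
      have Hf: "H has_fps_expansion fps_expansion H 0"
        by (rule has_fps_expansion_fps_expansion[OF open_UNIV _ H(1)]) simp
      have "(\<lambda>u. E u x) has_fps_expansion ?T + fps_shift 1 (G x) + fps_expansion H 0 * fps_const (1 / 2)"
        unfolding E_def by (intro fps_expansion_intros T Q Hf)
      from fps_nth_fps_expansion[OF this, of p]
      have "(deriv ^^ p) (\<lambda>u. E u x) 0 = fact p * fps_nth ?T p + fact p * fps_nth (G x) (Suc p) + fact p * fps_nth (fps_expansion H 0) p / 2"
        by (simp add: field_simps)
      also have "fact p * fps_nth ?T p = - ((- 1) ^ p * frakF0 (Suc p) x)"
        using higher_deriv_trapezoid_lattice_sum[OF x, of p] by (simp add: fps_expansion_def)
      also have "fact p * fps_nth (fps_expansion H 0) p = (- 1) ^ p * stieltjes_gamma p"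
        using H(3)[of p] by (simp add: fps_expansion_def)
      \<comment> \<open>Division by u moves the coefficient from index p + 1 to p. The factorial of
        p in place of that of p + 1 is the origin of the factor 1/k in \<open>calF\<close>.\<close>
      also have "fact p * fps_nth (G x) (Suc p) = (\<Sum>l=0..Suc p. (-1) ^ l / of_nat (Suc p) * of_nat (Suc p choose l) * ln x ^ l *
          (deriv ^^ (Suc p - l)) riemann_zeta 0)"
      proof -
        have "fact p * fps_nth (G x) (Suc p) =
          (\<Sum>l=0..Suc p. fact p * ((- ln x) ^ l / fact l * ((deriv ^^ (Suc p - l)) riemann_zeta 0 / fact (Suc p - l))))"
          by (simp add: G_def fps_mult_nth fps_expansion_def sum_distrib_left del: sum.cl_ivl_Suc)
        also have "\<dots> = (\<Sum>l=0..Suc p. (-1) ^ l / of_nat (Suc p) * of_nat (Suc p choose l) * ln x ^ l *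
          (deriv ^^ (Suc p - l)) riemann_zeta 0)"
        proof (rule sum.cong[OF refl])
          fix l assume "l \<in> {0..Suc p}"
          then have "of_nat (Suc p choose l) = (fact (Suc p) / (fact l * fact (Suc p - l)) :: complex)"
            by (intro binomial_fact) simp
          also have "\<dots> = of_nat (Suc p) * (fact p / (fact l * fact (Suc p - l)))"
            by simp
          finally show "fact p * ((- ln x) ^ l / fact l * ((deriv ^^ (Suc p - l)) riemann_zeta 0 / fact (Suc p - l))) =
            (-1) ^ l / of_nat (Suc p) * of_nat (Suc p choose l) * ln x ^ l * (deriv ^^ (Suc p - l)) riemann_zeta 0"
            by (simp add: power_minus[of "ln x" l] del: of_nat_Suc)
        qed
        finally show ?thesis .
      qed
      finally show ?thesis by (simp add: calF_def del: sum.cl_ivl_Suc of_nat_Suc)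
    qed
  qed
qed

text \<open>Carries an identity from the region of absolute convergence to a neighbourhood of u = 0,
  around the pole at u = 1.\<close>

lemma ball_minus_identity:
  fixes f g :: "complex \<Rightarrow> complex"
  assumes "f holomorphic_on ball 1 (3 / 2) - {1}" "g holomorphic_on ball 1 (3 / 2) - {1}"
    and "\<And>u. u \<in> ball 1 (3 / 2) \<Longrightarrow> Re u > 1 \<Longrightarrow> f u = g u" "u \<in> ball 1 (3 / 2) - {1}"
  shows "f u = g u"
proof (rule analytic_continuation_open[of "ball 1 (3 / 2) \<inter> {u. Re u > 1}" "ball 1 (3 / 2) - {1}" f g])
  show "open (ball 1 (3 / 2) \<inter> {u :: complex. Re u > 1})"
    by (intro open_Int open_ball open_halfspace_Re_gt)
  show "connected (ball 1 (3 / 2) - {1 :: complex})"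
    by (rule connected_punctured_ball) simp
  have "2 \<in> ball 1 (3 / 2) \<inter> {u :: complex. Re u > 1}" by (simp add: dist_norm)
  then show "ball 1 (3 / 2) \<inter> {u :: complex. Re u > 1} \<noteq> {}" by blast
qed (use assms in auto)

text \<open>The Leibniz rule, with the derivatives (1/y)(-ln y)^n of the power at 0; these supply
  the prefactors and the powers of logarithms in both functional equations.\<close>

lemma higher_deriv_inv_powr_mult:
  assumes "y \<noteq> 0" and f: "f holomorphic_on A" "open A" "0 \<in> A"
  shows "(deriv ^^ p) (\<lambda>u. f u * inv_powr u y) 0 =
    1 / y * (\<Sum>i=0..p. of_nat (p choose i) * (- ln y) ^ (p - i) * (deriv ^^ i) f 0)"
proof -
  have "(deriv ^^ n) (\<lambda>u. inv_powr u y) 0 = 1 / y * (- ln y) ^ n" for n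
    using fps_nth_fps_expansion[OF has_fps_expansion_inv_powr[OF assms(1)], of n] by (simp add: field_simps)
  then show ?thesis
    unfolding higher_deriv_mult[OF f(1) holomorphic_inv_powr f(2,3)] sum_distrib_left
    by (simp add: mult_ac)
qed

theorem theorem1p3:
  fixes k :: nat and x :: complex
  assumes "k \<ge> 1" and "x \<notin> \<real>\<^sub>\<le>\<^sub>0"
  shows "calF k x = 1 / x * (\<Sum>j=1..k. of_nat ((k - 1) choose (j - 1)) *
           ln (1 / x) ^ (k - j) * calF j (1 / x)) \<and>
         calF k x - calF k (x + 1) - 1 / (x + 1) * (\<Sum>j=1..k. of_nat ((k - 1) choose (j - 1)) *
           ln (1 / (x + 1)) ^ (k - j) * calF j (x / (x + 1))) = 0"
proof -
  note x = assms(2)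
  obtain p where k: "k = Suc p" using assms(1) by (cases k) auto
  let ?V = "ball (1 :: complex) (3 / 2) - {1}"
  obtain E where hol: "\<And>x. x \<notin> \<real>\<^sub>\<le>\<^sub>0 \<Longrightarrow> (\<lambda>u. E u x) holomorphic_on ?V"
    and deriv: "\<And>x p. x \<notin> \<real>\<^sub>\<le>\<^sub>0 \<Longrightarrow> (deriv ^^ p) (\<lambda>u. E u x) 0 = - calF (Suc p) x"
    and E: "\<And>x u. x \<notin> \<real>\<^sub>\<le>\<^sub>0 \<Longrightarrow> u \<in> ball 1 (3 / 2) \<Longrightarrow> Re u > 1 \<Longrightarrow>
       E u x = cone_sum u x + riemann_zeta (1 + u) * (1 + inv_powr u x) / 2"
    using period_function by blast
  have V: "open ?V" "0 \<in> ?V" by (auto simp: open_delete)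
  have x1: "x + 1 \<notin> \<real>\<^sub>\<le>\<^sub>0" using cone_not_nonpos[OF x, of 1 1] by simp
  have nz: "x \<noteq> 0" "x + 1 \<noteq> 0" using x x1 by auto
  \<comment> \<open>These match the boundary rays under the two substitutions; 1 is taken as the
    cone point 0 x + 1.\<close>
  have q: "inv_powr u x * inv_powr u (1 / x) = 1" "inv_powr u (x + 1) * inv_powr u (x / (x + 1)) = inv_powr u x" for u
    using inv_powr_cone_divide[OF x, of 0 1 1 0 u] inv_powr_cone_divide[OF x, of 1 0 1 1 u]
    by (simp_all add: inv_powr_def)
  have ln: "ln (1 / x) = - ln x" "ln (1 / (x + 1)) = - ln (x + 1)"
    using Ln_inverse[OF x] Ln_inverse[OF x1] by (simp_all add: inverse_eq_divide)
  have inv: "1 / x \<notin> \<real>\<^sub>\<le>\<^sub>0"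
    using x nonpos_Reals_inverse_iff[of x] by (simp add: inverse_eq_divide)
  have quot: "x / (x + 1) \<notin> \<real>\<^sub>\<le>\<^sub>0"
  proof
    assume "x / (x + 1) \<in> \<real>\<^sub>\<le>\<^sub>0"
    then have "inverse (x / (x + 1)) \<in> \<real>\<^sub>\<le>\<^sub>0" by (simp only: nonpos_Reals_inverse_iff)
    also have "inverse (x / (x + 1)) = 1 + 1 / x" using nz by (simp add: field_simps)
    finally show False using cone_not_nonpos[OF inv, of 1 1] by (simp add: add.commute)
  qed
  have 1: "E u x = E u (1 / x) * inv_powr u x" if "u \<in> ?V" for u
  proof (rule ball_minus_identity[OF _ _ _ that])
    fix u :: complex assume u: "u \<in> ball 1 (3 / 2)" "Re u > 1"
    show "E u x = E u (1 / x) * inv_powr u x"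
      unfolding E[OF x u] E[OF inv u] cone_sum_reciprocal[OF x, of u]
      using q(1)[of u] by algebra
  qed (intro holomorphic_intros hol holomorphic_inv_powr x inv)+
  have 2: "E u x - E u (x + 1) = E u (x / (x + 1)) * inv_powr u (x + 1)" if "u \<in> ?V" for u
  proof (rule ball_minus_identity[OF _ _ _ that])
    fix u :: complex assume u: "u \<in> ball 1 (3 / 2)" "Re u > 1"
    \<comment> \<open>The diagonal enters \<open>cone_sum_three_term\<close> with full weight: half
      of it is the boundary ray in \<open>E u (x + 1)\<close>, the other half that in the term with
      x/(x + 1).\<close>
    show "E u x - E u (x + 1) = E u (x / (x + 1)) * inv_powr u (x + 1)"
      unfolding E[OF x u] E[OF x1 u] E[OF quot u] cone_sum_three_term[OF x u(2)]
      unfolding q(2)[of u, symmetric] by (simp add: field_simps)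
  qed (intro holomorphic_intros hol holomorphic_inv_powr x x1 quot)+
  \<comment> \<open>Both identities hold in a full neighbourhood of 0, so they may be differentiated
    there.\<close>
  have nhds: "\<forall>\<^sub>F u in nhds 0. u \<in> ?V" using V by (rule eventually_nhds_in_open)
  have sum: "(\<Sum>j=1..k. of_nat ((k - 1) choose (j - 1)) * l ^ (k - j) * calF j y) =
      (\<Sum>i=0..p. of_nat (p choose i) * l ^ (p - i) * calF (Suc i) y)" for l y
    unfolding k One_nat_def sum.shift_bounds_cl_Suc_ivl by simp
  have "(deriv ^^ p) (\<lambda>u. E u x) 0 = (deriv ^^ p) (\<lambda>u. E u (1 / x) * inv_powr u x) 0"
    by (rule higher_deriv_cong_ev[OF eventually_mono[OF nhds 1] refl])
  then have "calF k x = 1 / x * (\<Sum>j=1..k. of_nat ((k - 1) choose (j - 1)) *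
           ln (1 / x) ^ (k - j) * calF j (1 / x))"
    unfolding higher_deriv_inv_powr_mult[OF nz(1) hol[OF inv] V] deriv[OF x] deriv[OF inv] sum ln
    by (simp add: k sum_negf)
  moreover have "(deriv ^^ p) (\<lambda>u. E u x - E u (x + 1)) 0 = (deriv ^^ p) (\<lambda>u. E u (x / (x + 1)) * inv_powr u (x + 1)) 0"
    by (rule higher_deriv_cong_ev[OF eventually_mono[OF nhds 2] refl])
  then have "calF k x - calF k (x + 1) = 1 / (x + 1) * (\<Sum>j=1..k. of_nat ((k - 1) choose (j - 1)) *
           ln (1 / (x + 1)) ^ (k - j) * calF j (x / (x + 1)))"
    unfolding higher_deriv_inv_powr_mult[OF nz(2) hol[OF quot] V] deriv[OF x] deriv[OF x1] deriv[OF quot]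
      higher_deriv_diff[OF hol[OF x] hol[OF x1] V] sum ln
    by (simp add: k sum_negf) (simp add: algebra_simps)
  ultimately show ?thesis by simp
qed

end
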